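(* Let $R$ be a commutative noetherian ring, let $\mathfrak a$ be an ideal of $R$, and let $\mathcal S$ be a Serre subcategory of $R$-modules satisfying the condition $C_{\mathfrak a}$. Let $M$ be an $\mathcal S$-$\mathfrak a$-cofinite $R$-module and let $N$ be a finitely generated $R$-module of (finite Krull) dimension $d$. Then $\operatorname{Ext}^i_R(N,M)\in\mathcal S$ for each $i\geq 0$.
   Context: A Serre subcategory of $R$-modules is a full subcategory of the category of all $R$-modules closed under submodules, quotients and extensions. $\mathcal S$ satisfies the condition $C_{\mathfrak a}$ if for every $R$-module $X$: if $\Gamma_{\mathfrak a}(X)=X$ and $(0:_X\mathfrak a)\in\mathcal S$, then $X\in\mathcal S$ (where $\Gamma_{\mathfrak a}$ is the $\mathfrak a$-torsion functor). An $R$-module $X$ is $\mathcal S$-$\mathfrak a$-cofinite if $\operatorname{Supp}_R X\subseteq V(\mathfrak a)$ and $\operatorname{Ext}^i_R(R/\mathfrak a,X)\in\mathcal S$ for all $i\geq 0$. *)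

theory Defs
  imports "HOL-Library.Extended_Real" "HOL-Algebra.Module" "HOL-Algebra.Ideal_Product" "HOL-Algebra.Ring_Divisibility"
begin

section \<open>Modules: homomorphisms, quotients, finite generation\<close>

text \<open>
  A module is a record of type \<open>('r, 'm) module\<close> satisfying the locale predicate \<open>module R X\<close>.
  That record type extends \<open>ring\<close>; its fields \<open>mult\<close> and \<open>one\<close> carry no information and
  are left undefined in the constructions below.
\<close>

definition mod_hom ::
  "('r, 'x) ring_scheme \<Rightarrow> ('r, 'a) module \<Rightarrow> ('r, 'b) module \<Rightarrow> ('a \<Rightarrow> 'b) set"
  where "mod_hom R X Y =
    {f \<in> carrier X \<rightarrow> carrier Y.
       (\<forall>x\<in>carrier X. \<forall>y\<in>carrier X. f (x \<oplus>\<^bsub>X\<^esub> y) = f x \<oplus>\<^bsub>Y\<^esub> f y) \<and>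
       (\<forall>r\<in>carrier R. \<forall>x\<in>carrier X. f (r \<odot>\<^bsub>X\<^esub> x) = r \<odot>\<^bsub>Y\<^esub> f x)}"

definition mod_iso :: "('r, 'x) ring_scheme \<Rightarrow> ('r, 'a) module \<Rightarrow> ('r, 'b) module \<Rightarrow> bool"
  where "mod_iso R X Y \<longleftrightarrow> (\<exists>f\<in>mod_hom R X Y. bij_betw f (carrier X) (carrier Y))"

definition mod_quot :: "('r, 'a) module \<Rightarrow> 'a set \<Rightarrow> ('r, 'a set) module"
  where "mod_quot X H =
    \<lparr>carrier = a_rcosets\<^bsub>X\<^esub> H, monoid.mult = undefined, one = undefined, zero = H, add = set_add X,
     smult = (\<lambda>r A. \<Union>x\<in>A. H +>\<^bsub>X\<^esub> (r \<odot>\<^bsub>X\<^esub> x))\<rparr>"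

definition ring_as_module :: "('r, 'x) ring_scheme \<Rightarrow> ('r, 'r) module"
  where "ring_as_module R =
    \<lparr>carrier = carrier R, monoid.mult = undefined, one = undefined, zero = \<zero>\<^bsub>R\<^esub>,
     add = (\<oplus>\<^bsub>R\<^esub>), smult = (\<otimes>\<^bsub>R\<^esub>)\<rparr>"

definition fin_gen_module :: "('r, 'x) ring_scheme \<Rightarrow> ('r, 'a) module \<Rightarrow> bool"
  where "fin_gen_module R X \<longleftrightarrow>
    (\<exists>A. finite A \<and> A \<subseteq> carrier X \<and> (\<forall>H. submodule H R X \<and> A \<subseteq> H \<longrightarrow> H = carrier X))"

section \<open>Localization, support, dimension\<close>

text \<open>
  \<open>localization R p X\<close> is \<open>X\<^sub>p\<close>, regarded as an \<open>R\<close>-module: equivalence classes of pairs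
  \<open>(x, s)\<close>, standing for \<open>x / s\<close>, where \<open>x\<close> lies in \<open>X\<close> and \<open>s\<close> in the complement of \<open>p\<close>.
\<close>

definition fraction_rel ::
  "('r, 'x) ring_scheme \<Rightarrow> 'r set \<Rightarrow> ('r, 'a) module \<Rightarrow> (('a \<times> 'r) \<times> ('a \<times> 'r)) set"
  where "fraction_rel R p X =
    {((x, s), (y, t)). x \<in> carrier X \<and> y \<in> carrier X \<and> s \<in> carrier R - p \<and> t \<in> carrier R - p \<and>
       (\<exists>u\<in>carrier R - p. u \<odot>\<^bsub>X\<^esub> (t \<odot>\<^bsub>X\<^esub> x) = u \<odot>\<^bsub>X\<^esub> (s \<odot>\<^bsub>X\<^esub> y))}"

definition localization ::
  "('r, 'x) ring_scheme \<Rightarrow> 'r set \<Rightarrow> ('r, 'a) module \<Rightarrow> ('r, ('a \<times> 'r) set) module"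
  where "localization R p X =
    \<lparr>carrier = (carrier X \<times> (carrier R - p)) // fraction_rel R p X,
     monoid.mult = undefined, one = undefined,
     zero = fraction_rel R p X `` {(\<zero>\<^bsub>X\<^esub>, \<one>\<^bsub>R\<^esub>)},
     add = (\<lambda>A B. \<Union>(x, s)\<in>A. \<Union>(y, t)\<in>B.
              fraction_rel R p X `` {((t \<odot>\<^bsub>X\<^esub> x) \<oplus>\<^bsub>X\<^esub> (s \<odot>\<^bsub>X\<^esub> y), s \<otimes>\<^bsub>R\<^esub> t)}),
     smult = (\<lambda>r A. \<Union>(x, s)\<in>A. fraction_rel R p X `` {(r \<odot>\<^bsub>X\<^esub> x, s)})\<rparr>"

definition Supp :: "('r, 'x) ring_scheme \<Rightarrow> ('r, 'a) module \<Rightarrow> 'r set set"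
  where "Supp R X =
    {p. primeideal p R \<and> carrier (localization R p X) \<noteq> {\<zero>\<^bsub>localization R p X\<^esub>}}"

definition zero_locus :: "('r, 'x) ring_scheme \<Rightarrow> 'r set \<Rightarrow> 'r set set"
  where "zero_locus R I = {p. primeideal p R \<and> I \<subseteq> p}"

text \<open>
  The Krull dimension of a module is the supremum of the lengths of chains of primes in its
  support. The zero module gets dimension \<open>-\<infinity>\<close>.
\<close>

definition krull_dim :: "('r, 'x) ring_scheme \<Rightarrow> ('r, 'a) module \<Rightarrow> ereal"
  where "krull_dim R X =
    Sup {ereal (real n) | n. \<exists>P. (\<forall>i\<le>n. P i \<in> Supp R X) \<and> (\<forall>i<n. P i \<subset> P (Suc i))}"

section \<open>Torsion\<close>

definition torsion_part :: "('r, 'x) ring_scheme \<Rightarrow> 'r set \<Rightarrow> ('r, 'a) module \<Rightarrow> 'a set"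
  where "torsion_part R I X =
    {x \<in> carrier X. \<exists>n::nat. \<forall>r \<in> I [^]\<^bsub>ideals_set R\<^esub> n. r \<odot>\<^bsub>X\<^esub> x = \<zero>\<^bsub>X\<^esub>}"

definition annihilated_part :: "'r set \<Rightarrow> ('r, 'a) module \<Rightarrow> ('r, 'a) module"
  where "annihilated_part I X = X\<lparr>carrier := {x \<in> carrier X. \<forall>r\<in>I. r \<odot>\<^bsub>X\<^esub> x = \<zero>\<^bsub>X\<^esub>}\<rparr>"

section \<open>Ext\<close>

definition hom_module ::
  "('r, 'x) ring_scheme \<Rightarrow> ('r, 'a) module \<Rightarrow> ('r, 'b) module \<Rightarrow> ('r, 'a \<Rightarrow> 'b) module"
  where "hom_module R X Y =
    \<lparr>carrier = mod_hom R X Y \<inter> extensional (carrier X),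
     monoid.mult = undefined, one = undefined,
     zero = (\<lambda>x\<in>carrier X. \<zero>\<^bsub>Y\<^esub>),
     add = (\<lambda>f g. \<lambda>x\<in>carrier X. f x \<oplus>\<^bsub>Y\<^esub> g x),
     smult = (\<lambda>r f. \<lambda>x\<in>carrier X. r \<odot>\<^bsub>Y\<^esub> f x)\<rparr>"

text \<open>
  For a complex \<open>F\<close> of modules with differentials \<open>d i : F (i + 1) \<rightarrow> F i\<close>, the \<open>i\<close>-th cohomology
  of the complex \<open>Hom(F, Y)\<close>.
\<close>

definition hom_cocycles ::
  "('r, 'x) ring_scheme \<Rightarrow> (nat \<Rightarrow> ('r, 'a) module) \<Rightarrow> (nat \<Rightarrow> 'a \<Rightarrow> 'a) \<Rightarrow> ('r, 'b) module
    \<Rightarrow> nat \<Rightarrow> ('a \<Rightarrow> 'b) set"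
  where "hom_cocycles R F d Y i =
    {f \<in> carrier (hom_module R (F i) Y). \<forall>x\<in>carrier (F (Suc i)). f (d i x) = \<zero>\<^bsub>Y\<^esub>}"

fun hom_coboundaries ::
  "('r, 'x) ring_scheme \<Rightarrow> (nat \<Rightarrow> ('r, 'a) module) \<Rightarrow> (nat \<Rightarrow> 'a \<Rightarrow> 'a) \<Rightarrow> ('r, 'b) module
    \<Rightarrow> nat \<Rightarrow> ('a \<Rightarrow> 'b) set"
  where
    "hom_coboundaries R F d Y 0 = {\<zero>\<^bsub>hom_module R (F 0) Y\<^esub>}"
  | "hom_coboundaries R F d Y (Suc i) =
       (\<lambda>f. \<lambda>x\<in>carrier (F (Suc i)). f (d i x)) ` carrier (hom_module R (F i) Y)"

definition hom_cohomology ::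
  "('r, 'x) ring_scheme \<Rightarrow> (nat \<Rightarrow> ('r, 'a) module) \<Rightarrow> (nat \<Rightarrow> 'a \<Rightarrow> 'a) \<Rightarrow> ('r, 'b) module
    \<Rightarrow> nat \<Rightarrow> ('r, ('a \<Rightarrow> 'b) set) module"
  where "hom_cohomology R F d Y i =
    mod_quot ((hom_module R (F i) Y)\<lparr>carrier := hom_cocycles R F d Y i\<rparr>)
             (hom_coboundaries R F d Y i)"

text \<open>The free module on a set \<open>G\<close>: finitely supported functions.\<close>

definition free_module :: "('r, 'x) ring_scheme \<Rightarrow> 'g set \<Rightarrow> ('r, 'g \<Rightarrow> 'r) module"
  where "free_module R G =
    \<lparr>carrier = {f. (\<forall>g\<in>G. f g \<in> carrier R) \<and> (\<forall>g. g \<notin> G \<longrightarrow> f g = \<zero>\<^bsub>R\<^esub>) \<and>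
                   finite {g. f g \<noteq> \<zero>\<^bsub>R\<^esub>}},
     monoid.mult = undefined, one = undefined,
     zero = (\<lambda>g. \<zero>\<^bsub>R\<^esub>),
     add = (\<lambda>f f' g. f g \<oplus>\<^bsub>R\<^esub> f' g),
     smult = (\<lambda>r f g. r \<otimes>\<^bsub>R\<^esub> f g)\<rparr>"

definition lin_ext ::
  "('r, 'x) ring_scheme \<Rightarrow> ('r, 'a) module \<Rightarrow> ('g \<Rightarrow> 'a) \<Rightarrow> ('g \<Rightarrow> 'r) \<Rightarrow> 'a"
  where "lin_ext R X \<phi> f = (\<Oplus>\<^bsub>X\<^esub> g \<in> {g. f g \<noteq> \<zero>\<^bsub>R\<^esub>}. f g \<odot>\<^bsub>X\<^esub> \<phi> g)"

text \<open>
  Ext is computed from a concrete free resolution \<open>\<dots> \<rightarrow> F 1 \<rightarrow> F 0 \<rightarrow> X\<close>. The generators of \<open>F 0\<close>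
  are the elements of \<open>X\<close>. Those of \<open>F (i + 1)\<close> are all formal expressions
  \<open>r\<^sub>1 g\<^sub>1 + \<dots> + r\<^sub>k g\<^sub>k\<close> in generators \<open>g\<^sub>j\<close> of \<open>F i\<close> whose value in \<open>F i\<close> lies in the kernel of
  the map leaving \<open>F i\<close>, and the differential sends such a generator to that value. Encoding
  formal expressions as lists in a recursive datatype places all the \<open>F i\<close> in one type.
  As usual, a different projective resolution would give an isomorphic Ext; \<open>std_resolution\<close>
  below states that this one is exact.
\<close>

datatype ('r, 'a) gen = Gen (gen_elem: 'a) | Rel (gen_expr: "('r \<times> ('r, 'a) gen) list")

primrec expr_value :: "('r, 'x) ring_scheme \<Rightarrow> ('r \<times> 'g) list \<Rightarrow> 'g \<Rightarrow> 'r"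
  where
    "expr_value R [] = (\<lambda>h. \<zero>\<^bsub>R\<^esub>)"
  | "expr_value R (p # ps) = (\<lambda>h. (if h = snd p then fst p else \<zero>\<^bsub>R\<^esub>) \<oplus>\<^bsub>R\<^esub> expr_value R ps h)"

definition relation_gens ::
  "('r, 'x) ring_scheme \<Rightarrow> ('r, 'a) gen set \<Rightarrow> (('r, 'a) gen \<Rightarrow> 'r) set \<Rightarrow> ('r, 'a) gen set"
  where "relation_gens R G K = {Rel ps | ps. set ps \<subseteq> carrier R \<times> G \<and> expr_value R ps \<in> K}"

definition std_aug :: "('r, 'x) ring_scheme \<Rightarrow> ('r, 'a) module \<Rightarrow> (('r, 'a) gen \<Rightarrow> 'r) \<Rightarrow> 'a"
  where "std_aug R X = lin_ext R X gen_elem"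

definition gen_diff ::
  "('r, 'x) ring_scheme \<Rightarrow> ('r, 'a) gen set \<Rightarrow> (('r, 'a) gen \<Rightarrow> 'r) \<Rightarrow> (('r, 'a) gen \<Rightarrow> 'r)"
  where "gen_diff R G = lin_ext R (free_module R G) (\<lambda>g. expr_value R (gen_expr g))"

fun std_gens :: "('r, 'x) ring_scheme \<Rightarrow> ('r, 'a) module \<Rightarrow> nat \<Rightarrow> ('r, 'a) gen set"
  where
    "std_gens R X 0 = Gen ` carrier X"
  | "std_gens R X (Suc 0) =
       relation_gens R (std_gens R X 0) {f. std_aug R X f = \<zero>\<^bsub>X\<^esub>}"
  | "std_gens R X (Suc (Suc i)) =
       relation_gens R (std_gens R X (Suc i))
         {f. gen_diff R (std_gens R X i) f = \<zero>\<^bsub>free_module R (std_gens R X i)\<^esub>}"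

definition std_res ::
  "('r, 'x) ring_scheme \<Rightarrow> ('r, 'a) module \<Rightarrow> nat \<Rightarrow> ('r, ('r, 'a) gen \<Rightarrow> 'r) module"
  where "std_res R X i = free_module R (std_gens R X i)"

definition std_diff ::
  "('r, 'x) ring_scheme \<Rightarrow> ('r, 'a) module \<Rightarrow> nat \<Rightarrow> (('r, 'a) gen \<Rightarrow> 'r) \<Rightarrow> (('r, 'a) gen \<Rightarrow> 'r)"
  where "std_diff R X i = gen_diff R (std_gens R X i)"

definition Ext ::
  "('r, 'x) ring_scheme \<Rightarrow> nat \<Rightarrow> ('r, 'a) module \<Rightarrow> ('r, 'b) module
    \<Rightarrow> ('r, ((('r, 'a) gen \<Rightarrow> 'r) \<Rightarrow> 'b) set) module"
  where "Ext R i X Y = hom_cohomology R (std_res R X) (std_diff R X) Y i"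

subsection \<open>The resolution is a free resolution\<close>

lemma free_module_simps:
  "zero (free_module R G) = (\<lambda>g. \<zero>\<^bsub>R\<^esub>)"
  "add (free_module R G) f f' = (\<lambda>g. f g \<oplus>\<^bsub>R\<^esub> f' g)"
  "smult (free_module R G) r f = (\<lambda>g. r \<otimes>\<^bsub>R\<^esub> f g)"
  by (simp_all add: free_module_def)

lemma free_module_carrier_iff:
  "f \<in> carrier (free_module R G) \<longleftrightarrow>
     (\<forall>g\<in>G. f g \<in> carrier R) \<and> (\<forall>g. g \<notin> G \<longrightarrow> f g = \<zero>\<^bsub>R\<^esub>) \<and> finite {g. f g \<noteq> \<zero>\<^bsub>R\<^esub>}"
  by (simp add: free_module_def)

lemma free_module_value:
  assumes "cring R" "f \<in> carrier (free_module R G)"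
  shows "f g \<in> carrier R"
proof -
  interpret cring R by fact
  show ?thesis using assms(2) by (cases "g \<in> G") (auto simp: free_module_carrier_iff)
qed

lemma module_free_module:
  assumes "cring R"
  shows "module R (free_module R G)"
proof -
  interpret cring R by fact
  note val = free_module_value[OF assms]
  let ?F = "free_module R G"
  have add_closed: "add ?F f f' \<in> carrier ?F" if "f \<in> carrier ?F" "f' \<in> carrier ?F" for f f'
  proof -
    have "{g. f g \<oplus>\<^bsub>R\<^esub> f' g \<noteq> \<zero>\<^bsub>R\<^esub>} \<subseteq> {g. f g \<noteq> \<zero>\<^bsub>R\<^esub>} \<union> {g. f' g \<noteq> \<zero>\<^bsub>R\<^esub>}"
      by auto
    moreover have "finite \<dots>" using that by (auto simp: free_module_carrier_iff)
    ultimately have "finite {g. f g \<oplus>\<^bsub>R\<^esub> f' g \<noteq> \<zero>\<^bsub>R\<^esub>}"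
      by (rule finite_subset)
    then show ?thesis
      using that by (auto simp: free_module_carrier_iff free_module_simps)
  qed
  have smult_closed: "smult ?F r f \<in> carrier ?F" if "r \<in> carrier R" "f \<in> carrier ?F" for r f
  proof -
    have "{g. r \<otimes>\<^bsub>R\<^esub> f g \<noteq> \<zero>\<^bsub>R\<^esub>} \<subseteq> {g. f g \<noteq> \<zero>\<^bsub>R\<^esub>}"
      using that by auto
    moreover have "finite \<dots>" using that by (auto simp: free_module_carrier_iff)
    ultimately have "finite {g. r \<otimes>\<^bsub>R\<^esub> f g \<noteq> \<zero>\<^bsub>R\<^esub>}"
      by (rule finite_subset)
    then show ?thesis
      using that by (auto simp: free_module_carrier_iff free_module_simps)
  qed
  have neg: "(\<lambda>g. \<ominus>\<^bsub>R\<^esub> f g) \<in> carrier ?F" if "f \<in> carrier ?F" for f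
  proof -
    have "{g. \<ominus>\<^bsub>R\<^esub> f g \<noteq> \<zero>\<^bsub>R\<^esub>} \<subseteq> {g. f g \<noteq> \<zero>\<^bsub>R\<^esub>}"
      by auto
    moreover have "finite \<dots>" using that by (auto simp: free_module_carrier_iff)
    ultimately have "finite {g. \<ominus>\<^bsub>R\<^esub> f g \<noteq> \<zero>\<^bsub>R\<^esub>}"
      by (rule finite_subset)
    then show ?thesis
      using that by (auto simp: free_module_carrier_iff free_module_simps)
  qed
  show ?thesis
  proof (rule moduleI)
    show "abelian_group ?F"
    proof (rule abelian_groupI)
      show "\<zero>\<^bsub>?F\<^esub> \<in> carrier ?F" by (simp add: free_module_carrier_iff free_module_simps)
      fix f assume f: "f \<in> carrier ?F"
      show "\<exists>f'\<in>carrier ?F. f' \<oplus>\<^bsub>?F\<^esub> f = \<zero>\<^bsub>?F\<^esub>"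
        using neg[OF f] val[OF f] by (intro bexI[of _ "\<lambda>g. \<ominus>\<^bsub>R\<^esub> f g"])
          (auto simp: free_module_simps l_neg)
    qed (use add_closed in \<open>auto simp: free_module_simps val a_assoc a_comm a_lcomm\<close>)
  qed (use assms smult_closed in \<open>auto simp: free_module_simps val l_distr r_distr m_assoc\<close>)
qed

lemma expr_value_closed:
  assumes "cring R" "set ps \<subseteq> carrier R \<times> G"
  shows "expr_value R ps \<in> carrier (free_module R G)"
  using assms(2)
proof (induction ps)
  case Nil
  interpret cring R by fact
  show ?case by (simp add: free_module_carrier_iff)
next
  case (Cons p ps)
  interpret cring R by fact
  interpret F: module R "free_module R G" by (rule module_free_module) fact
  have "(\<lambda>h. if h = snd p then fst p else \<zero>\<^bsub>R\<^esub>) \<in> carrier (free_module R G)"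
    using Cons.prems by (auto simp: free_module_carrier_iff)
  from F.add.m_closed[OF this Cons.IH] Cons.prems show ?case
    by (simp add: free_module_simps)
qed

lemma expr_value_onto:
  assumes "cring R" "f \<in> carrier (free_module R G)"
  obtains ps where "set ps \<subseteq> carrier R \<times> G" "expr_value R ps = f"
proof -
  interpret cring R by fact
  note val = free_module_value[OF assms]
  have "finite {g. f g \<noteq> \<zero>\<^bsub>R\<^esub>}" using assms(2) by (simp add: free_module_carrier_iff)
  then obtain gs where gs: "set gs = {g. f g \<noteq> \<zero>\<^bsub>R\<^esub>}" "distinct gs"
    using finite_distinct_list by blast
  have eq: "expr_value R (map (\<lambda>g. (f g, g)) hs) = (\<lambda>h. if h \<in> set hs then f h else \<zero>\<^bsub>R\<^esub>)"
    if "distinct hs" for hs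
    using that by (induction hs) (auto simp: fun_eq_iff val)
  show ?thesis
  proof (rule that)
    show "set (map (\<lambda>g. (f g, g)) gs) \<subseteq> carrier R \<times> G"
      using gs(1) val assms(2) by (auto simp: free_module_carrier_iff)
    show "expr_value R (map (\<lambda>g. (f g, g)) gs) = f"
      using eq[OF gs(2)] gs(1) by (auto simp: fun_eq_iff)
  qed
qed

lemma lin_ext_superset:
  assumes "module R X" "f \<in> carrier (free_module R G)" "\<phi> \<in> G \<rightarrow> carrier X"
    and "finite A" "{g. f g \<noteq> \<zero>\<^bsub>R\<^esub>} \<subseteq> A" "A \<subseteq> G"
  shows "lin_ext R X \<phi> f = (\<Oplus>\<^bsub>X\<^esub>g\<in>A. f g \<odot>\<^bsub>X\<^esub> \<phi> g)"
proof -
  interpret module R X by fact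
  have "cring R" ..
  note val = free_module_value[OF this assms(2)]
  show ?thesis
    unfolding lin_ext_def
    by (rule M.add.finprod_mono_neutral_cong_left)
       (use assms val in \<open>auto simp: Pi_iff subset_iff\<close>)
qed

lemma lin_ext_hom:
  assumes "module R X" "\<phi> \<in> G \<rightarrow> carrier X"
  shows "lin_ext R X \<phi> \<in> mod_hom R (free_module R G) X"
proof -
  interpret module R X by fact
  have cr: "cring R" ..
  interpret F: module R "free_module R G" by (rule module_free_module[OF cr])
  let ?F = "free_module R G"
  note val = free_module_value[OF cr]
  have supp: "finite {g. f g \<noteq> \<zero>\<^bsub>R\<^esub>}" "{g. f g \<noteq> \<zero>\<^bsub>R\<^esub>} \<subseteq> G" if "f \<in> carrier ?F" for f
    using that by (auto simp: free_module_carrier_iff)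
  have phi: "\<phi> g \<in> carrier X" if "g \<in> G" for g using assms(2) that by auto
  have closed: "lin_ext R X \<phi> f \<in> carrier X" if "f \<in> carrier ?F" for f
    unfolding lin_ext_def using supp[OF that] val[OF that] phi
    by (intro M.finsum_closed) auto
  have "lin_ext R X \<phi> (f \<oplus>\<^bsub>?F\<^esub> f') = lin_ext R X \<phi> f \<oplus>\<^bsub>X\<^esub> lin_ext R X \<phi> f'"
    if f: "f \<in> carrier ?F" and f': "f' \<in> carrier ?F" for f f'
  proof -
    let ?A = "{g. f g \<noteq> \<zero>\<^bsub>R\<^esub>} \<union> {g. f' g \<noteq> \<zero>\<^bsub>R\<^esub>}"
    have A: "finite ?A" "?A \<subseteq> G" using supp[OF f] supp[OF f'] by auto
    have s: "{g. (f \<oplus>\<^bsub>?F\<^esub> f') g \<noteq> \<zero>\<^bsub>R\<^esub>} \<subseteq> ?A" by (auto simp: free_module_simps)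
    have "lin_ext R X \<phi> (f \<oplus>\<^bsub>?F\<^esub> f') = (\<Oplus>\<^bsub>X\<^esub>g\<in>?A. (f \<oplus>\<^bsub>?F\<^esub> f') g \<odot>\<^bsub>X\<^esub> \<phi> g)"
      by (rule lin_ext_superset[OF assms(1) F.add.m_closed[OF f f'] assms(2) A(1) s A(2)])
    also have "\<dots> = (\<Oplus>\<^bsub>X\<^esub>g\<in>?A. f g \<odot>\<^bsub>X\<^esub> \<phi> g \<oplus>\<^bsub>X\<^esub> f' g \<odot>\<^bsub>X\<^esub> \<phi> g)"
      by (rule M.finsum_cong')
         (use A(2) val[OF f] val[OF f'] phi in \<open>auto simp: free_module_simps smult_l_distr subset_iff\<close>)
    also have "\<dots> = (\<Oplus>\<^bsub>X\<^esub>g\<in>?A. f g \<odot>\<^bsub>X\<^esub> \<phi> g) \<oplus>\<^bsub>X\<^esub> (\<Oplus>\<^bsub>X\<^esub>g\<in>?A. f' g \<odot>\<^bsub>X\<^esub> \<phi> g)"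
      by (rule M.finsum_addf) (use A(2) val[OF f] val[OF f'] phi in \<open>auto simp: subset_iff\<close>)
    also have "(\<Oplus>\<^bsub>X\<^esub>g\<in>?A. f g \<odot>\<^bsub>X\<^esub> \<phi> g) = lin_ext R X \<phi> f"
      by (rule lin_ext_superset[OF assms(1) f assms(2) A(1) _ A(2), symmetric]) auto
    also have "(\<Oplus>\<^bsub>X\<^esub>g\<in>?A. f' g \<odot>\<^bsub>X\<^esub> \<phi> g) = lin_ext R X \<phi> f'"
      by (rule lin_ext_superset[OF assms(1) f' assms(2) A(1) _ A(2), symmetric]) auto
    finally show ?thesis .
  qed
  moreover have "lin_ext R X \<phi> (r \<odot>\<^bsub>?F\<^esub> f) = r \<odot>\<^bsub>X\<^esub> lin_ext R X \<phi> f"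
    if r: "r \<in> carrier R" and f: "f \<in> carrier ?F" for r f
  proof -
    let ?A = "{g. f g \<noteq> \<zero>\<^bsub>R\<^esub>}"
    have A: "finite ?A" "?A \<subseteq> G" using supp[OF f] by auto
    have s: "{g. (r \<odot>\<^bsub>?F\<^esub> f) g \<noteq> \<zero>\<^bsub>R\<^esub>} \<subseteq> ?A" using r by (auto simp: free_module_simps)
    have "lin_ext R X \<phi> (r \<odot>\<^bsub>?F\<^esub> f) = (\<Oplus>\<^bsub>X\<^esub>g\<in>?A. (r \<odot>\<^bsub>?F\<^esub> f) g \<odot>\<^bsub>X\<^esub> \<phi> g)"
      by (rule lin_ext_superset[OF assms(1) F.smult_closed[OF r f] assms(2) A(1) s A(2)])
    also have "\<dots> = (\<Oplus>\<^bsub>X\<^esub>g\<in>?A. r \<odot>\<^bsub>X\<^esub> (f g \<odot>\<^bsub>X\<^esub> \<phi> g))"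
      by (rule M.finsum_cong')
         (use A(2) val[OF f] r phi in \<open>auto simp: free_module_simps smult_assoc1 subset_iff\<close>)
    also have "\<dots> = r \<odot>\<^bsub>X\<^esub> lin_ext R X \<phi> f"
      unfolding lin_ext_def
      by (rule finsum_smult_ldistr[symmetric]) (use A r val[OF f] phi in \<open>auto simp: subset_iff\<close>)
    finally show ?thesis .
  qed
  ultimately show ?thesis using closed by (simp add: mod_hom_def Pi_iff)
qed

lemma lin_ext_basis:
  assumes "module R X" "\<phi> \<in> G \<rightarrow> carrier X" "g \<in> G"
  obtains b where "b \<in> carrier (free_module R G)" "lin_ext R X \<phi> b = \<phi> g"
proof -
  interpret module R X by fact
  let ?b = "\<lambda>h. if h = g then \<one>\<^bsub>R\<^esub> else \<zero>\<^bsub>R\<^esub>"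
  have b: "?b \<in> carrier (free_module R G)"
    using assms(3) by (auto simp: free_module_carrier_iff)
  have "lin_ext R X \<phi> ?b = (\<Oplus>\<^bsub>X\<^esub>h\<in>{g}. ?b h \<odot>\<^bsub>X\<^esub> \<phi> h)"
    by (rule lin_ext_superset[OF assms(1) b assms(2)]) (use assms(3) in auto)
  also have "\<dots> = \<phi> g" using assms by (simp add: Pi_iff)
  finally show ?thesis using b that by blast
qed

lemma gen_diff_exact:
  assumes "cring R" "module R Y" "e \<in> mod_hom R (free_module R G) Y"
  defines "G' \<equiv> relation_gens R G {f. e f = \<zero>\<^bsub>Y\<^esub>}"
  shows "gen_diff R G \<in> mod_hom R (free_module R G') (free_module R G)"
    and "gen_diff R G ` carrier (free_module R G') = {f \<in> carrier (free_module R G). e f = \<zero>\<^bsub>Y\<^esub>}"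
proof -
  let ?F = "free_module R G" and ?\<phi> = "\<lambda>g. expr_value R (gen_expr g)"
  interpret F: module R ?F by (rule module_free_module) fact
  interpret Y: module R Y by fact
  have F: "module R ?F" by (rule module_free_module) fact
  have phi: "?\<phi> g \<in> carrier ?F" "e (?\<phi> g) = \<zero>\<^bsub>Y\<^esub>" if "g \<in> G'" for g
    using that expr_value_closed[OF assms(1)] by (auto simp: G'_def relation_gens_def)
  then have phi': "?\<phi> \<in> G' \<rightarrow> carrier ?F" by auto
  show "gen_diff R G \<in> mod_hom R (free_module R G') ?F"
    unfolding gen_diff_def by (rule lin_ext_hom[OF F phi'])
  have e_add: "e (f \<oplus>\<^bsub>?F\<^esub> f') = e f \<oplus>\<^bsub>Y\<^esub> e f'" if "f \<in> carrier ?F" "f' \<in> carrier ?F" for f f'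
    using assms(3) that by (simp add: mod_hom_def)
  have e_smult: "e (r \<odot>\<^bsub>?F\<^esub> f) = r \<odot>\<^bsub>Y\<^esub> e f" if "r \<in> carrier R" "f \<in> carrier ?F" for r f
    using assms(3) that by (simp add: mod_hom_def)
  have e_zero: "e \<zero>\<^bsub>?F\<^esub> = \<zero>\<^bsub>Y\<^esub>"
    using e_smult[of "\<zero>\<^bsub>R\<^esub>" "\<zero>\<^bsub>?F\<^esub>"] assms(3) by (simp add: mod_hom_def Pi_iff)
  have ker: "gen_diff R G f \<in> {f \<in> carrier ?F. e f = \<zero>\<^bsub>Y\<^esub>}"
    if f: "f \<in> carrier (free_module R G')" for f
  proof -
    have "(\<Oplus>\<^bsub>?F\<^esub>g\<in>A. f g \<odot>\<^bsub>?F\<^esub> ?\<phi> g) \<in> carrier ?F \<and> e (\<Oplus>\<^bsub>?F\<^esub>g\<in>A. f g \<odot>\<^bsub>?F\<^esub> ?\<phi> g) = \<zero>\<^bsub>Y\<^esub>"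
      if "finite A" "A \<subseteq> G'" for A
      using that
    proof (induction A rule: finite_induct)
      case empty
      then show ?case by (simp add: e_zero)
    next
      case (insert g A)
      have c: "f h \<odot>\<^bsub>?F\<^esub> ?\<phi> h \<in> carrier ?F" if "h \<in> insert g A" for h
        using insert.prems that phi free_module_value[OF assms(1) f] by blast
      have "e (f g \<odot>\<^bsub>?F\<^esub> ?\<phi> g) = \<zero>\<^bsub>Y\<^esub>"
        using insert.prems phi free_module_value[OF assms(1) f] by (simp add: e_smult)
      with insert c show ?case by (simp add: F.M.finsum_insert e_add Pi_iff)
    qed
    then show ?thesis
      using f unfolding gen_diff_def lin_ext_def by (auto simp: free_module_carrier_iff)
  qed
  show "gen_diff R G ` carrier (free_module R G') = {f \<in> carrier ?F. e f = \<zero>\<^bsub>Y\<^esub>}"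
  proof
    show "gen_diff R G ` carrier (free_module R G') \<subseteq> {f \<in> carrier ?F. e f = \<zero>\<^bsub>Y\<^esub>}"
      using ker by blast
    show "{f \<in> carrier ?F. e f = \<zero>\<^bsub>Y\<^esub>} \<subseteq> gen_diff R G ` carrier (free_module R G')"
    proof
      fix f assume f: "f \<in> {f \<in> carrier ?F. e f = \<zero>\<^bsub>Y\<^esub>}"
      then obtain ps where ps: "set ps \<subseteq> carrier R \<times> G" "expr_value R ps = f"
        using expr_value_onto[OF assms(1)] by blast
      then have "Rel ps \<in> G'" using f by (auto simp: G'_def relation_gens_def)
      from lin_ext_basis[OF F phi' this] obtain b where
        "b \<in> carrier (free_module R G')" "lin_ext R ?F ?\<phi> b = expr_value R ps"
        by auto
      then show "f \<in> gen_diff R G ` carrier (free_module R G')"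
        using ps(2) by (metis gen_diff_def image_eqI)
    qed
  qed
qed

theorem std_resolution:
  assumes "module R X"
  shows "std_aug R X \<in> mod_hom R (std_res R X 0) X"
    and "std_diff R X i \<in> mod_hom R (std_res R X (Suc i)) (std_res R X i)"
    and "std_aug R X ` carrier (std_res R X 0) = carrier X"
    and "std_diff R X 0 ` carrier (std_res R X (Suc 0)) =
           {f \<in> carrier (std_res R X 0). std_aug R X f = \<zero>\<^bsub>X\<^esub>}"
    and "std_diff R X (Suc i) ` carrier (std_res R X (Suc (Suc i))) =
           {f \<in> carrier (std_res R X (Suc i)). std_diff R X i f = \<zero>\<^bsub>std_res R X i\<^esub>}"
proof -
  interpret module R X by fact
  have cr: "cring R" ..
  have gen: "gen_elem \<in> Gen ` carrier X \<rightarrow> carrier X" by auto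
  show aug: "std_aug R X \<in> mod_hom R (std_res R X 0) X"
    using lin_ext_hom[OF assms gen] by (simp add: std_aug_def std_res_def)
  show "std_aug R X ` carrier (std_res R X 0) = carrier X"
  proof
    show "std_aug R X ` carrier (std_res R X 0) \<subseteq> carrier X"
      using aug by (auto simp: mod_hom_def)
    show "carrier X \<subseteq> std_aug R X ` carrier (std_res R X 0)"
    proof
      fix x assume "x \<in> carrier X"
      then have "Gen x \<in> Gen ` carrier X" by simp
      from lin_ext_basis[OF assms gen this] show "x \<in> std_aug R X ` carrier (std_res R X 0)"
        unfolding std_aug_def std_res_def by (metis gen.sel(1) image_eqI std_gens.simps(1))
    qed
  qed
  note zeroth = gen_diff_exact[OF cr assms aug[unfolded std_res_def]]
  show "std_diff R X 0 ` carrier (std_res R X (Suc 0)) =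
           {f \<in> carrier (std_res R X 0). std_aug R X f = \<zero>\<^bsub>X\<^esub>}"
    using zeroth(2) by (simp add: std_diff_def std_res_def)
  have diff: "std_diff R X j \<in> mod_hom R (std_res R X (Suc j)) (std_res R X j)" for j
  proof (induction j)
    case 0
    then show ?case using zeroth(1) by (simp add: std_diff_def std_res_def)
  next
    case (Suc j)
    show ?case
      using gen_diff_exact(1)[OF cr module_free_module[OF cr] Suc.IH[unfolded std_res_def]]
      by (simp add: std_diff_def std_res_def)
  qed
  then show "std_diff R X i \<in> mod_hom R (std_res R X (Suc i)) (std_res R X i)" .
  show "std_diff R X (Suc i) ` carrier (std_res R X (Suc (Suc i))) =
           {f \<in> carrier (std_res R X (Suc i)). std_diff R X i f = \<zero>\<^bsub>std_res R X i\<^esub>}"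
    using gen_diff_exact(2)[OF cr module_free_module[OF cr] diff[of i, unfolded std_res_def]]
    by (simp add: std_diff_def std_res_def)
qed

section \<open>Serre subcategories\<close>

text \<open>
  A type \<open>'u\<close> plays the role of the universe: the category of \<open>R\<close>-modules consists of all modules
  whose carrier is a set of elements of \<open>'u\<close>, and a full subcategory is given by its class of
  objects. Submodules and quotients are taken up to isomorphism, that is, as objects admitting an
  injective homomorphism into, respectively a surjective one from, the given module. A Serre
  subcategory of all \<open>R\<close>-modules, and the condition \<open>condition_C\<close> below, restrict to every such
  universe; a result for all infinite types \<open>'u\<close> (so that universes are closed under finite
  direct sums) therefore covers modules of every size.
\<close>

definition serre_subcategory :: "('r, 'x) ring_scheme \<Rightarrow> ('r, 'u) module set \<Rightarrow> bool"
  where "serre_subcategory R S \<longleftrightarrow>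
    (\<forall>X\<in>S. module R X) \<and>
    (\<forall>X Y f. Y \<in> S \<and> module R X \<and> f \<in> mod_hom R X Y \<and> inj_on f (carrier X) \<longrightarrow> X \<in> S) \<and>
    (\<forall>X Y f. X \<in> S \<and> module R Y \<and> f \<in> mod_hom R X Y \<and> f ` carrier X = carrier Y \<longrightarrow> Y \<in> S) \<and>
    (\<forall>X Y Z f g. X \<in> S \<and> Z \<in> S \<and> module R Y \<and>
       f \<in> mod_hom R X Y \<and> inj_on f (carrier X) \<and>
       g \<in> mod_hom R Y Z \<and> g ` carrier Y = carrier Z \<and>
       f ` carrier X = {y \<in> carrier Y. g y = \<zero>\<^bsub>Z\<^esub>} \<longrightarrow> Y \<in> S)"

text \<open>
  Modules such as Ext live on other types than \<open>'u\<close>. They belong to \<open>S\<close> if they are isomorphic to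
  an object of \<open>S\<close>.
\<close>

definition belongs :: "('r, 'x) ring_scheme \<Rightarrow> ('r, 'u) module set \<Rightarrow> ('r, 'a) module \<Rightarrow> bool"
  where "belongs R S X \<longleftrightarrow> (\<exists>Y\<in>S. mod_iso R X Y)"

definition condition_C :: "('r, 'x) ring_scheme \<Rightarrow> 'r set \<Rightarrow> ('r, 'u) module set \<Rightarrow> bool"
  where "condition_C R I S \<longleftrightarrow>
    (\<forall>X. module R X \<and> torsion_part R I X = carrier X \<and> annihilated_part I X \<in> S \<longrightarrow> X \<in> S)"

definition cofinite_module ::
  "('r, 'x) ring_scheme \<Rightarrow> ('r, 'u) module set \<Rightarrow> 'r set \<Rightarrow> ('r, 'a) module \<Rightarrow> bool"
  where "cofinite_module R S I X \<longleftrightarrow>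
    module R X \<and> Supp R X \<subseteq> zero_locus R I \<and>
    (\<forall>i. belongs R S (Ext R i (mod_quot (ring_as_module R) I) X))"

end

theory Submission
  imports Defs
begin

text \<open>
  Since \<open>R\<close> is noetherian, the support condition makes \<open>M\<close> an \<open>I\<close>-torsion module, and
  \<open>Ext\<^sup>0(R/I, M) = (0 :\<^sub>M I)\<close> lies in \<open>S\<close>; hence \<open>M\<close> itself lies in \<open>S\<close> by the condition on \<open>S\<close>.
  For finitely generated \<open>N\<close>, the standard resolution has in each degree an endomorphism that is
  homotopic to the identity and has finitely generated image. A cocycle that vanishes on finitely
  many elements generating this image is a coboundary, so \<open>Ext\<^sup>i(N, M)\<close> is a quotient of a
  submodule of a finite power of \<open>M\<close>.
\<close>

section \<open>Modules, homomorphisms and quotients\<close>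

text \<open>The terms of the standard resolution are free on very large sets, so
  \<open>Hom(F i, M)\<close> is in general an infinite power of \<open>M\<close>, which a Serre
  class need not contain. The usual remedy is a second resolution by finitely generated free modules
  together with the comparison theorem. Here no two resolutions are compared: finiteness is
  extracted from the standard resolution itself, by homotopies chosen on basis vectors. A second
  obstacle is size. \<open>S\<close> contains only modules carried by subsets of \<open>'u\<close>,
  whereas Ext and the intermediate quotients live on other types. The closure properties of
  \<open>S\<close> are therefore re-established for \<open>belongs\<close>, each time through an
  injection of the new carrier into \<open>'u\<close>. For extensions and finite direct sums this
  injection comes from one of \<open>'u \<times> 'u\<close> into \<open>'u\<close>, which is where
  the universe has to be infinite.\<close>

lemma mod_homI:
  assumes "\<And>x. x \<in> carrier X \<Longrightarrow> f x \<in> carrier Y"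
    and "\<And>x y. \<lbrakk>x \<in> carrier X; y \<in> carrier X\<rbrakk> \<Longrightarrow> f (x \<oplus>\<^bsub>X\<^esub> y) = f x \<oplus>\<^bsub>Y\<^esub> f y"
    and "\<And>r x. \<lbrakk>r \<in> carrier R; x \<in> carrier X\<rbrakk> \<Longrightarrow> f (r \<odot>\<^bsub>X\<^esub> x) = r \<odot>\<^bsub>Y\<^esub> f x"
  shows "f \<in> mod_hom R X Y"
  using assms by (simp add: mod_hom_def)

lemma mod_hom_closed: "\<lbrakk>f \<in> mod_hom R X Y; x \<in> carrier X\<rbrakk> \<Longrightarrow> f x \<in> carrier Y"
  and mod_hom_add:
    "\<lbrakk>f \<in> mod_hom R X Y; x \<in> carrier X; y \<in> carrier X\<rbrakk> \<Longrightarrow> f (x \<oplus>\<^bsub>X\<^esub> y) = f x \<oplus>\<^bsub>Y\<^esub> f y"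
  and mod_hom_smult:
    "\<lbrakk>f \<in> mod_hom R X Y; r \<in> carrier R; x \<in> carrier X\<rbrakk> \<Longrightarrow> f (r \<odot>\<^bsub>X\<^esub> x) = r \<odot>\<^bsub>Y\<^esub> f x"
  by (auto simp: mod_hom_def)

lemma mod_hom_zero:
  assumes "module R X" "module R Y" "f \<in> mod_hom R X Y"
  shows "f \<zero>\<^bsub>X\<^esub> = \<zero>\<^bsub>Y\<^esub>"
proof -
  interpret X: module R X by fact
  interpret Y: module R Y by fact
  show ?thesis
    using mod_hom_smult[OF assms(3), of "\<zero>\<^bsub>R\<^esub>" "\<zero>\<^bsub>X\<^esub>"] mod_hom_closed[OF assms(3), of "\<zero>\<^bsub>X\<^esub>"]
    by simp
qed

text \<open>\<open>mod_hom\<close> and \<open>submodule_intro\<close> speak only of addition and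
  scalars, so negation is always traded for the scalar -1.\<close>

lemma module_minus_eq:
  assumes "module R X" "x \<in> carrier X"
  shows "\<ominus>\<^bsub>X\<^esub> x = (\<ominus>\<^bsub>R\<^esub> \<one>\<^bsub>R\<^esub>) \<odot>\<^bsub>X\<^esub> x"
proof -
  interpret X: module R X by fact
  show ?thesis using assms(2) by (simp add: X.smult_l_minus)
qed

lemma mod_hom_minus:
  assumes "module R X" "module R Y" "f \<in> mod_hom R X Y" "x \<in> carrier X"
  shows "f (\<ominus>\<^bsub>X\<^esub> x) = \<ominus>\<^bsub>Y\<^esub> f x"
proof -
  interpret X: module R X by fact
  show ?thesis
    using mod_hom_smult[OF assms(3) _ assms(4), of "\<ominus>\<^bsub>R\<^esub> \<one>\<^bsub>R\<^esub>"] mod_hom_closed[OF assms(3,4)]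
    by (simp add: module_minus_eq[OF assms(1,4)] module_minus_eq[OF assms(2)])
qed

lemma mod_hom_diff:
  assumes "module R X" "module R Y" "f \<in> mod_hom R X Y" "x \<in> carrier X" "y \<in> carrier X"
  shows "f (x \<ominus>\<^bsub>X\<^esub> y) = f x \<ominus>\<^bsub>Y\<^esub> f y"
proof -
  interpret X: module R X by fact
  show ?thesis
    using assms by (simp add: a_minus_def mod_hom_add[OF assms(3)] mod_hom_minus[OF assms(1-3)])
qed

lemma mod_hom_comp:
  "\<lbrakk>f \<in> mod_hom R X Y; g \<in> mod_hom R Y Z\<rbrakk> \<Longrightarrow> (\<lambda>x. g (f x)) \<in> mod_hom R X Z"
  by (auto simp: mod_hom_def Pi_iff)

lemma mod_hom_id: "(\<lambda>x. x) \<in> mod_hom R X X"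
  by (simp add: mod_hom_def)

lemma module_diff_zero_iff:
  assumes "module R X" "x \<in> carrier X" "y \<in> carrier X"
  shows "x \<ominus>\<^bsub>X\<^esub> y = \<zero>\<^bsub>X\<^esub> \<longleftrightarrow> x = y"
proof -
  interpret X: module R X by fact
  have "(x \<ominus>\<^bsub>X\<^esub> y) \<oplus>\<^bsub>X\<^esub> y = x"
    using assms(2,3) by (simp add: a_minus_def X.M.a_assoc X.M.l_neg)
  then show ?thesis using assms(2,3) by (auto simp: a_minus_def X.M.r_neg)
qed

lemma mod_hom_diff_fun:
  assumes "module R Y" "f \<in> mod_hom R X Y" "g \<in> mod_hom R X Y"
  shows "(\<lambda>x. f x \<ominus>\<^bsub>Y\<^esub> g x) \<in> mod_hom R X Y"
proof -
  interpret Y: module R Y by fact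
  note cl = mod_hom_closed[OF assms(2)] mod_hom_closed[OF assms(3)]
  show ?thesis
  proof (rule mod_homI)
    fix x y assume "x \<in> carrier X" "y \<in> carrier X"
    with cl have "f x \<in> carrier Y" "f y \<in> carrier Y" "g x \<in> carrier Y" "g y \<in> carrier Y"
      by auto
    with \<open>x \<in> carrier X\<close> \<open>y \<in> carrier X\<close>
    show "f (x \<oplus>\<^bsub>X\<^esub> y) \<ominus>\<^bsub>Y\<^esub> g (x \<oplus>\<^bsub>X\<^esub> y) = f x \<ominus>\<^bsub>Y\<^esub> g x \<oplus>\<^bsub>Y\<^esub> (f y \<ominus>\<^bsub>Y\<^esub> g y)"
      by (simp add: mod_hom_add[OF assms(2)] mod_hom_add[OF assms(3)] a_minus_def Y.minus_add
          Y.M.a_ac)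
  qed (use cl in \<open>auto simp: mod_hom_smult[OF assms(2)] mod_hom_smult[OF assms(3)] a_minus_def
        Y.smult_r_distr Y.smult_r_minus\<close>)
qed

lemma mod_hom_inj_iff:
  assumes "module R X" "module R Y" "f \<in> mod_hom R X Y"
  shows "inj_on f (carrier X) \<longleftrightarrow> (\<forall>x\<in>carrier X. f x = \<zero>\<^bsub>Y\<^esub> \<longrightarrow> x = \<zero>\<^bsub>X\<^esub>)"
proof -
  interpret X: module R X by fact
  interpret Y: module R Y by fact
  note zero = mod_hom_zero[OF assms]
  show ?thesis
  proof
    assume "inj_on f (carrier X)"
    then show "\<forall>x\<in>carrier X. f x = \<zero>\<^bsub>Y\<^esub> \<longrightarrow> x = \<zero>\<^bsub>X\<^esub>"
      using zero by (metis X.M.zero_closed inj_onD)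
  next
    assume *: "\<forall>x\<in>carrier X. f x = \<zero>\<^bsub>Y\<^esub> \<longrightarrow> x = \<zero>\<^bsub>X\<^esub>"
    show "inj_on f (carrier X)"
    proof (rule inj_onI)
      fix x y assume xy: "x \<in> carrier X" "y \<in> carrier X" "f x = f y"
      then have "f (x \<ominus>\<^bsub>X\<^esub> y) = \<zero>\<^bsub>Y\<^esub>"
        using mod_hom_closed[OF assms(3)]
        by (simp add: mod_hom_diff[OF assms] module_diff_zero_iff[OF assms(2)])
      with * xy have "x \<ominus>\<^bsub>X\<^esub> y = \<zero>\<^bsub>X\<^esub>" by simp
      with xy show "x = y" by (simp add: module_diff_zero_iff[OF assms(1)])
    qed
  qed
qed

section \<open>Submodules, images and preimages\<close>

lemma submodule_intro:
  assumes "module R X" "H \<subseteq> carrier X" "\<zero>\<^bsub>X\<^esub> \<in> H"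
    and "\<And>x y. \<lbrakk>x \<in> H; y \<in> H\<rbrakk> \<Longrightarrow> x \<oplus>\<^bsub>X\<^esub> y \<in> H"
    and "\<And>r x. \<lbrakk>r \<in> carrier R; x \<in> H\<rbrakk> \<Longrightarrow> r \<odot>\<^bsub>X\<^esub> x \<in> H"
  shows "submodule H R X"
proof -
  interpret X: module R X by fact
  show ?thesis
    using assms(2-) by (intro X.submoduleI) (auto simp: module_minus_eq[OF assms(1)] subset_iff)
qed

lemma submodule_subset: "submodule H R X \<Longrightarrow> H \<subseteq> carrier X"
  and submodule_zero: "submodule H R X \<Longrightarrow> \<zero>\<^bsub>X\<^esub> \<in> H"
  and submodule_add: "\<lbrakk>submodule H R X; x \<in> H; y \<in> H\<rbrakk> \<Longrightarrow> x \<oplus>\<^bsub>X\<^esub> y \<in> H"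
  and submodule_smult: "\<lbrakk>submodule H R X; r \<in> carrier R; x \<in> H\<rbrakk> \<Longrightarrow> r \<odot>\<^bsub>X\<^esub> x \<in> H"
  using subgroup.subset[of H "add_monoid X"] subgroup.one_closed[of H "add_monoid X"]
    subgroup.m_closed[of H "add_monoid X"] submodule.smult_closed[of H R X]
  by (auto simp: submodule_def)

lemma submodule_diff:
  assumes "module R X" "submodule H R X" "x \<in> H" "y \<in> H"
  shows "x \<ominus>\<^bsub>X\<^esub> y \<in> H"
  using module.submoduleE(3)[OF assms(1,2,4)] assms(2-) by (simp add: a_minus_def submodule_add)

lemma submodule_module:
  "\<lbrakk>module R X; submodule H R X\<rbrakk> \<Longrightarrow> module R (X\<lparr>carrier := H\<rparr>)"
  by (rule submodule.submodule_is_module)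

lemma mod_hom_restrict_domain:
  "\<lbrakk>f \<in> mod_hom R X Y; submodule H R X\<rbrakk> \<Longrightarrow> f \<in> mod_hom R (X\<lparr>carrier := H\<rparr>) Y"
  by (rule mod_homI) (auto dest: submodule_subset simp: subset_iff mod_hom_closed mod_hom_add mod_hom_smult)

lemma mod_hom_restrict_codomain:
  "\<lbrakk>f \<in> mod_hom R X Y; f ` carrier X \<subseteq> H\<rbrakk> \<Longrightarrow> f \<in> mod_hom R X (Y\<lparr>carrier := H\<rparr>)"
  by (auto simp: mod_hom_def Pi_iff)

lemma submodule_image:
  assumes "module R X" "module R Y" "f \<in> mod_hom R X Y" "submodule H R X"
  shows "submodule (f ` H) R Y"
proof (rule submodule_intro[OF assms(2)])
  note sub = submodule_subset[OF assms(4), THEN subsetD]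
  show "f ` H \<subseteq> carrier Y" using sub mod_hom_closed[OF assms(3)] by auto
  show "\<zero>\<^bsub>Y\<^esub> \<in> f ` H"
    using mod_hom_zero[OF assms(1-3)] submodule_zero[OF assms(4)] by force
  show "x \<oplus>\<^bsub>Y\<^esub> y \<in> f ` H" if "x \<in> f ` H" "y \<in> f ` H" for x y
  proof -
    from that obtain a b where "a \<in> H" "b \<in> H" "x = f a" "y = f b" by auto
    then have "f (a \<oplus>\<^bsub>X\<^esub> b) = x \<oplus>\<^bsub>Y\<^esub> y" by (simp add: sub mod_hom_add[OF assms(3)])
    then show ?thesis
      using submodule_add[OF assms(4) \<open>a \<in> H\<close> \<open>b \<in> H\<close>] by (metis imageI)
  qed
  show "r \<odot>\<^bsub>Y\<^esub> x \<in> f ` H" if "r \<in> carrier R" "x \<in> f ` H" for r x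
  proof -
    from that obtain a where "a \<in> H" "x = f a" by auto
    then have "f (r \<odot>\<^bsub>X\<^esub> a) = r \<odot>\<^bsub>Y\<^esub> x" by (simp add: sub that mod_hom_smult[OF assms(3)])
    then show ?thesis
      using submodule_smult[OF assms(4) that(1) \<open>a \<in> H\<close>] by (metis imageI)
  qed
qed

lemma submodule_carrier: "module R X \<Longrightarrow> submodule (carrier X) R X"
  by (rule module.carrier_is_submodule)

lemma submodule_vimage:
  assumes "module R X" "module R Y" "f \<in> mod_hom R X Y" "submodule H R Y"
  shows "submodule {x \<in> carrier X. f x \<in> H} R X"
proof -
  interpret X: module R X by fact
  show ?thesis
    by (rule submodule_intro[OF assms(1)])
       (use assms in \<open>auto simp: mod_hom_zero mod_hom_add mod_hom_smult submodule_zero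
          submodule_add submodule_smult\<close>)
qed

lemma submodule_kernel:
  assumes "module R X" "module R Y" "f \<in> mod_hom R X Y"
  shows "submodule {x \<in> carrier X. f x = \<zero>\<^bsub>Y\<^esub>} R X"
proof -
  interpret Y: module R Y by fact
  have "submodule {\<zero>\<^bsub>Y\<^esub>} R Y" by (rule submodule_intro[OF assms(2)]) auto
  from submodule_vimage[OF assms this] show ?thesis by simp
qed

lemma submodule_Int:
  assumes "module R X" "submodule H R X" "submodule K R X"
  shows "submodule (H \<inter> K) R X"
  by (rule submodule_intro[OF assms(1)])
     (use assms(2,3) submodule_subset in \<open>auto simp: submodule_zero submodule_add submodule_smult\<close>)

text \<open>Every axiom for \<open>Y\<close> is an identity between images under \<open>f\<close>,
  so it descends from \<open>X\<close>. This produces the module structure on quotients and on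
  transported copies. The value at zero is a hypothesis because \<open>mod_hom_zero\<close> derives
  it only when the target is already known to be a module.\<close>

lemma module_of_surj:
  assumes "module R X" "f \<in> mod_hom R X Y" "f ` carrier X = carrier Y" "f \<zero>\<^bsub>X\<^esub> = \<zero>\<^bsub>Y\<^esub>"
  shows "module R Y"
proof -
  interpret X: module R X by fact
  note hom = mod_hom_add[OF assms(2), symmetric] mod_hom_smult[OF assms(2), symmetric]
  have cl: "f x \<in> carrier Y" if "x \<in> carrier X" for x using that assms(3) by blast
  show ?thesis
  proof (rule moduleI)
    show "abelian_group Y"
    proof (rule abelian_groupI)
      show "\<zero>\<^bsub>Y\<^esub> \<in> carrier Y" using assms(3,4) X.M.zero_closed by (metis imageI)
      show "\<exists>z\<in>carrier Y. z \<oplus>\<^bsub>Y\<^esub> y = \<zero>\<^bsub>Y\<^esub>" if "y \<in> carrier Y" for y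
      proof -
        from that obtain x where "x \<in> carrier X" "y = f x" using assms(3) by blast
        then show ?thesis
          using cl by (intro bexI[of _ "f (\<ominus>\<^bsub>X\<^esub> x)"]) (auto simp: hom assms(4) X.M.l_neg)
      qed
    qed (auto simp: assms(3,4)[symmetric] hom X.M.a_ac)
  qed (auto simp: assms(3)[symmetric] hom X.is_cring X.smult_l_distr X.smult_r_distr X.smult_assoc1)
qed

section \<open>Quotient modules and factorization of homomorphisms\<close>

lemma module_abelian_subgroup:
  assumes "module R X" "submodule H R X"
  shows "abelian_subgroup H X"
proof -
  interpret X: module R X by fact
  show ?thesis
    using assms(2) by (intro abelian_subgroupI3 additive_subgroup.intro)
      (auto simp: submodule_def X.abelian_group_axioms)
qed

lemma mod_quot_proj:
  assumes "module R X" "submodule H R X"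
  shows "(\<lambda>x. H +>\<^bsub>X\<^esub> x) \<in> mod_hom R X (mod_quot X H)"
    and "(\<lambda>x. H +>\<^bsub>X\<^esub> x) ` carrier X = carrier (mod_quot X H)"
    and "module R (mod_quot X H)"
    and "\<And>x. x \<in> carrier X \<Longrightarrow> H +>\<^bsub>X\<^esub> x = \<zero>\<^bsub>mod_quot X H\<^esub> \<longleftrightarrow> x \<in> H"
proof -
  interpret X: module R X by fact
  interpret H: abelian_subgroup H X by (rule module_abelian_subgroup[OF assms])
  show surj: "(\<lambda>x. H +>\<^bsub>X\<^esub> x) ` carrier X = carrier (mod_quot X H)"
    by (auto simp: mod_quot_def A_RCOSETS_def')
  \<comment> \<open>The scalar multiplication of \<open>mod_quot\<close> is a union over all
    representatives; it collapses to one coset because they all give the same one.\<close>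
  have "H +>\<^bsub>X\<^esub> (r \<odot>\<^bsub>X\<^esub> x) = (\<Union>y\<in>H +>\<^bsub>X\<^esub> x. H +>\<^bsub>X\<^esub> (r \<odot>\<^bsub>X\<^esub> y))"
    if r: "r \<in> carrier R" and x: "x \<in> carrier X" for r x
  proof -
    have "H +>\<^bsub>X\<^esub> (r \<odot>\<^bsub>X\<^esub> y) = H +>\<^bsub>X\<^esub> (r \<odot>\<^bsub>X\<^esub> x)" if "y \<in> H +>\<^bsub>X\<^esub> x" for y
    proof -
      from that obtain h where h: "h \<in> H" "y = h \<oplus>\<^bsub>X\<^esub> x" by (auto simp: a_r_coset_def')
      then have "r \<odot>\<^bsub>X\<^esub> y = (r \<odot>\<^bsub>X\<^esub> h) \<oplus>\<^bsub>X\<^esub> (r \<odot>\<^bsub>X\<^esub> x)"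
        using r x H.a_Hcarr by (simp add: X.smult_r_distr)
      then have "r \<odot>\<^bsub>X\<^esub> y \<in> H +>\<^bsub>X\<^esub> (r \<odot>\<^bsub>X\<^esub> x)"
        using submodule_smult[OF assms(2) r h(1)] by (auto simp: a_r_coset_def')
      then show ?thesis
        using H.a_repr_independence' r x by auto
    qed
    moreover have "x \<in> H +>\<^bsub>X\<^esub> x" by (rule H.a_rcos_self[OF x])
    ultimately show ?thesis by blast
  qed
  then show hom: "(\<lambda>x. H +>\<^bsub>X\<^esub> x) \<in> mod_hom R X (mod_quot X H)"
    using surj by (intro mod_homI) (auto simp: mod_quot_def H.a_rcos_sum)
  have zero: "H +>\<^bsub>X\<^esub> x = \<zero>\<^bsub>mod_quot X H\<^esub> \<longleftrightarrow> x \<in> H" if "x \<in> carrier X" for x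
  proof
    assume "H +>\<^bsub>X\<^esub> x = \<zero>\<^bsub>mod_quot X H\<^esub>"
    then show "x \<in> H" using H.a_rcos_self[OF that] by (simp add: mod_quot_def)
  next
    assume "x \<in> H"
    then show "H +>\<^bsub>X\<^esub> x = \<zero>\<^bsub>mod_quot X H\<^esub>"
      using H.a_rcos_const by (simp add: mod_quot_def)
  qed
  then show "\<And>x. x \<in> carrier X \<Longrightarrow> H +>\<^bsub>X\<^esub> x = \<zero>\<^bsub>mod_quot X H\<^esub> \<longleftrightarrow> x \<in> H" .
  show "module R (mod_quot X H)"
    by (rule module_of_surj[OF assms(1) hom surj]) (simp add: zero submodule_zero[OF assms(2)])
qed

lemma module_ring_as_module:
  assumes "cring R"
  shows "module R (ring_as_module R)"
proof -
  interpret cring R by fact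
  have "abelian_group (ring_as_module R)"
    by (rule abelian_groupI) (auto simp: ring_as_module_def a_ac intro: bexI[of _ "\<ominus>\<^bsub>R\<^esub> _"] l_neg)
  then show ?thesis
    by (intro moduleI) (auto simp: ring_as_module_def l_distr r_distr m_assoc assms)
qed

lemma submodule_ideal:
  assumes "cring R" "ideal I R"
  shows "submodule I R (ring_as_module R)"
proof -
  interpret I: ideal I R by fact
  show ?thesis
    by (rule submodule_intro[OF module_ring_as_module[OF assms(1)]])
       (use I.Icarr I.I_l_closed in \<open>auto simp: ring_as_module_def\<close>)
qed

text \<open>The homomorphism theorem with the image of \<open>p\<close> in place of a quotient:
  \<open>p z\<close> determines \<open>z\<close> up to the kernel of \<open>p\<close>, on which
  \<open>q\<close> vanishes.\<close>

lemma mod_hom_factor: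
  assumes "module R Z" "module R P" "module R Q" "p \<in> mod_hom R Z P" "q \<in> mod_hom R Z Q"
    and ker: "\<And>z. \<lbrakk>z \<in> carrier Z; p z = \<zero>\<^bsub>P\<^esub>\<rbrakk> \<Longrightarrow> q z = \<zero>\<^bsub>Q\<^esub>"
  obtains g where "g \<in> mod_hom R (P\<lparr>carrier := p ` carrier Z\<rparr>) Q"
    and "\<And>z. z \<in> carrier Z \<Longrightarrow> g (p z) = q z"
proof -
  interpret Z: module R Z by fact
  define g where "g = (\<lambda>y. q (SOME z. z \<in> carrier Z \<and> p z = y))"
  have eq: "q z = q z'" if "z \<in> carrier Z" "z' \<in> carrier Z" "p z = p z'" for z z'
  proof -
    have "p (z \<ominus>\<^bsub>Z\<^esub> z') = \<zero>\<^bsub>P\<^esub>"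
      using that mod_hom_closed[OF assms(4)]
      by (simp add: mod_hom_diff[OF assms(1,2,4)] module_diff_zero_iff[OF assms(2)])
    then have "q z \<ominus>\<^bsub>Q\<^esub> q z' = \<zero>\<^bsub>Q\<^esub>"
      using that ker by (simp flip: mod_hom_diff[OF assms(1,3,5)])
    then show ?thesis
      using that mod_hom_closed[OF assms(5)] by (simp add: module_diff_zero_iff[OF assms(3)])
  qed
  have g: "g (p z) = q z" if "z \<in> carrier Z" for z
  proof -
    have "(SOME z'. z' \<in> carrier Z \<and> p z' = p z) \<in> carrier Z \<and>
        p (SOME z'. z' \<in> carrier Z \<and> p z' = p z) = p z"
      by (rule someI[of _ z]) (use that in simp)
    then show ?thesis using eq that unfolding g_def by blast
  qed
  have "g \<in> mod_hom R (P\<lparr>carrier := p ` carrier Z\<rparr>) Q"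
    by (rule mod_homI)
       (auto simp: g mod_hom_closed[OF assms(5)] mod_hom_add[OF assms(5)] mod_hom_smult[OF assms(5)]
         simp flip: mod_hom_add[OF assms(4)] mod_hom_smult[OF assms(4)])
  with g that show ?thesis by blast
qed

section \<open>Serre classes on modules of arbitrary type\<close>

lemma mod_hom_inv_into:
  assumes "module R X" "f \<in> mod_hom R X Y" "bij_betw f (carrier X) (carrier Y)"
  shows "inv_into (carrier X) f \<in> mod_hom R Y X"
proof -
  interpret X: module R X by fact
  have inj: "inj_on f (carrier X)" and surj: "f ` carrier X = carrier Y"
    using assms(3) by (auto simp: bij_betw_def)
  have inv: "inv_into (carrier X) f (f x) = x" if "x \<in> carrier X" for x
    by (rule inv_into_f_f[OF inj that])
  show ?thesis
    by (rule mod_homI)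
       (auto simp: inv simp flip: surj mod_hom_add[OF assms(2)] mod_hom_smult[OF assms(2)])
qed

text \<open>The structure is copied along any injection; \<open>j\<close> need not be onto, since
  the new carrier is its image. This is how a module on a foreign type is placed on
  \<open>'u\<close>.\<close>

lemma module_transport:
  fixes j :: "'a \<Rightarrow> 'b" and X :: "('r, 'a) module"
  assumes "module R X" "inj_on j (carrier X)"
  obtains X' :: "('r, 'b) module"
  where "module R X'" "j \<in> mod_hom R X X'" "bij_betw j (carrier X) (carrier X')"
proof -
  interpret X: module R X by fact
  define k where "k = inv_into (carrier X) j"
  have k: "k (j x) = x" if "x \<in> carrier X" for x
    unfolding k_def by (rule inv_into_f_f[OF assms(2) that])
  define X' :: "('r, 'b) module" where
    "X' = \<lparr>carrier = j ` carrier X, monoid.mult = undefined, one = undefined, zero = j \<zero>\<^bsub>X\<^esub>,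
      add = (\<lambda>a b. j (k a \<oplus>\<^bsub>X\<^esub> k b)), smult = (\<lambda>r a. j (r \<odot>\<^bsub>X\<^esub> k a))\<rparr>"
  have hom: "j \<in> mod_hom R X X'" by (rule mod_homI) (auto simp: X'_def k)
  moreover have "module R X'" by (rule module_of_surj[OF assms(1) hom]) (auto simp: X'_def)
  moreover have "bij_betw j (carrier X) (carrier X')"
    using assms(2) by (simp add: X'_def bij_betw_def)
  ultimately show ?thesis using that by blast
qed

lemma serre_module: "\<lbrakk>serre_subcategory R S; X \<in> S\<rbrakk> \<Longrightarrow> module R X"
  unfolding serre_subcategory_def by (erule conjE) (erule (1) bspec)

lemma serre_sub:
  assumes "serre_subcategory R S" "Y \<in> S" "module R X" "f \<in> mod_hom R X Y" "inj_on f (carrier X)"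
  shows "X \<in> S"
proof -
  note * = assms(1)[unfolded serre_subcategory_def, THEN conjunct2, THEN conjunct1]
  show ?thesis
    by (rule *[THEN spec, of X, THEN spec, of Y, THEN spec, of f, THEN mp])
       (intro conjI; rule assms(2-))
qed

lemma serre_quot:
  assumes "serre_subcategory R S" "X \<in> S" "module R Y" "f \<in> mod_hom R X Y"
    and "f ` carrier X = carrier Y"
  shows "Y \<in> S"
proof -
  note * = assms(1)[unfolded serre_subcategory_def, THEN conjunct2, THEN conjunct2, THEN conjunct1]
  show ?thesis
    by (rule *[THEN spec, of X, THEN spec, of Y, THEN spec, of f, THEN mp])
       (intro conjI; rule assms(2-))
qed

lemma serre_ext:
  assumes "serre_subcategory R S" "X \<in> S" "Z \<in> S" "module R Y"
    and "f \<in> mod_hom R X Y" "inj_on f (carrier X)" "g \<in> mod_hom R Y Z" "g ` carrier Y = carrier Z"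
    and "f ` carrier X = {y \<in> carrier Y. g y = \<zero>\<^bsub>Z\<^esub>}"
  shows "Y \<in> S"
proof -
  note * = assms(1)[unfolded serre_subcategory_def, THEN conjunct2, THEN conjunct2, THEN conjunct2]
  show ?thesis
    by (rule *[THEN spec, of X, THEN spec, of Y, THEN spec, of Z, THEN spec, of f, THEN spec, of g,
          THEN mp])
       (intro conjI; rule assms(2-))
qed

lemma belongsI:
  "\<lbrakk>Y \<in> S; f \<in> mod_hom R X Y; bij_betw f (carrier X) (carrier Y)\<rbrakk> \<Longrightarrow> belongs R S X"
  unfolding belongs_def mod_iso_def by blast

lemma belongs_member: "X \<in> S \<Longrightarrow> belongs R S X"
  by (rule belongsI[OF _ mod_hom_id]) (auto simp: bij_betw_def)

lemma belongsE:
  assumes "belongs R S X" "module R X"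
  obtains Y f g where "Y \<in> S" "f \<in> mod_hom R X Y" "g \<in> mod_hom R Y X"
    "\<And>x. x \<in> carrier X \<Longrightarrow> g (f x) = x" "\<And>y. y \<in> carrier Y \<Longrightarrow> f (g y) = y"
proof -
  obtain Y f where Y: "Y \<in> S" "f \<in> mod_hom R X Y" "bij_betw f (carrier X) (carrier Y)"
    using assms(1) unfolding belongs_def mod_iso_def by blast
  from that[OF Y(1,2) mod_hom_inv_into[OF assms(2) Y(2,3)]] Y(3) show ?thesis
    by (simp add: bij_betw_inv_into_left bij_betw_inv_into_right)
qed

section \<open>Closure of a Serre class, up to isomorphism and across types\<close>

lemma belongs_sub:
  assumes "serre_subcategory R S" "belongs R S Y" "module R X" "module R Y"
    and "f \<in> mod_hom R X Y" "inj_on f (carrier X)"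
  shows "belongs R S X"
proof -
  obtain Y' h k where Y': "Y' \<in> S" "h \<in> mod_hom R Y Y'" "\<And>y. y \<in> carrier Y \<Longrightarrow> k (h y) = y"
    using belongsE[OF assms(2,4)] by metis
  define j where "j = (\<lambda>x. h (f x))"
  have mY': "module R Y'" by (rule serre_module[OF assms(1) Y'(1)])
  have j: "j \<in> mod_hom R X Y'" unfolding j_def by (rule mod_hom_comp[OF assms(5) Y'(2)])
  have inj: "inj_on j (carrier X)"
    using assms(6) Y'(3) mod_hom_closed[OF assms(5)] unfolding j_def inj_on_def by metis
  have sub: "submodule (j ` carrier X) R Y'"
    by (rule submodule_image[OF assms(3) mY' j submodule_carrier[OF assms(3)]])
  \<comment> \<open>The image lies inside \<open>Y'\<close>, hence on \<open>'u\<close>, so closure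
    of \<open>S\<close> under submodules applies to it directly.\<close>
  let ?X' = "Y'\<lparr>carrier := j ` carrier X\<rparr>"
  have "?X' \<in> S"
    by (rule serre_sub[OF assms(1) Y'(1) submodule_module[OF mY' sub]
        mod_hom_restrict_domain[OF mod_hom_id sub]]) auto
  then show ?thesis
    by (rule belongsI[OF _ mod_hom_restrict_codomain[OF j subset_refl]])
       (use inj in \<open>simp add: bij_betw_def\<close>)
qed

text \<open>A quotient may live on any type. Choosing preimages under \<open>f\<close> embeds its
  carrier into the copy of \<open>X\<close> in \<open>S\<close>, so it can be moved to
  \<open>'u\<close> before closure under quotients applies.\<close>

lemma belongs_quot:
  assumes "serre_subcategory R S" "belongs R S X" "module R X" "module R Y"
    and "f \<in> mod_hom R X Y" "f ` carrier X = carrier Y"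
  shows "belongs R S Y"
proof -
  obtain X' h k where X': "X' \<in> S" "h \<in> mod_hom R X X'" "k \<in> mod_hom R X' X"
    "\<And>x. x \<in> carrier X \<Longrightarrow> k (h x) = x"
    using belongsE[OF assms(2,3)] by metis
  define j where "j = (\<lambda>y. h (inv_into (carrier X) f y))"
  have "inj_on j (carrier Y)"
  proof (rule inj_onI)
    fix y z assume yz: "y \<in> carrier Y" "z \<in> carrier Y" "j y = j z"
    then have "inv_into (carrier X) f y = inv_into (carrier X) f z"
      using X'(4) assms(6) unfolding j_def by (metis inv_into_into)
    with yz assms(6) show "y = z" by (metis f_inv_into_f)
  qed
  then obtain Y' where Y': "module R Y'" "j \<in> mod_hom R Y Y'" "bij_betw j (carrier Y) (carrier Y')"
    using module_transport[OF assms(4)] by blast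
  have q: "(\<lambda>x. j (f (k x))) \<in> mod_hom R X' Y'"
    by (rule mod_hom_comp[OF mod_hom_comp[OF X'(3) assms(5)] Y'(2)])
  have "k ` carrier X' = carrier X"
    using X'(4) mod_hom_closed[OF X'(2)] mod_hom_closed[OF X'(3)] by force
  then have "(\<lambda>x. j (f (k x))) ` carrier X' = carrier Y'"
    using assms(6) Y'(3) by (metis bij_betw_imp_surj_on image_image)
  then have "Y' \<in> S" by (rule serre_quot[OF assms(1) X'(1) Y'(1) q])
  then show ?thesis by (rule belongsI[OF _ Y'(2,3)])
qed

text \<open>An infinite cardinal equals its square.\<close>

lemma infinite_pair_injection:
  assumes "infinite (UNIV :: 'u set)"
  obtains e :: "'u \<times> 'u \<Rightarrow> 'u" where "inj e"
proof -
  have "\<exists>e. bij_betw e ((UNIV :: 'u set) \<times> (UNIV :: 'u set)) (UNIV :: 'u set)"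
    unfolding card_of_ordIso by (rule card_of_Times_same_infinite[OF assms])
  then obtain e where "bij_betw e ((UNIV :: 'u set) \<times> (UNIV :: 'u set)) (UNIV :: 'u set)" ..
  then have "inj_on e (UNIV \<times> UNIV)" by (rule bij_betw_imp_inj_on)
  then show ?thesis unfolding UNIV_Times_UNIV by (rule that)
qed

text \<open>As a set, \<open>Y\<close> is no larger than the product of \<open>Z\<close> and
  \<open>X\<close>: an element is determined by its image in \<open>Z\<close> and its difference
  from a chosen lift of that image. Coding pairs inside \<open>'u\<close> then gives a copy of
  \<open>Y\<close> on \<open>'u\<close>.\<close>

lemma belongs_ext:
  fixes S :: "('r, 'u) module set"
  assumes "infinite (UNIV :: 'u set)" "serre_subcategory R S"
    and "belongs R S X" "belongs R S Z" "module R X" "module R Y" "module R Z"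
    and "f \<in> mod_hom R X Y" "inj_on f (carrier X)" "g \<in> mod_hom R Y Z" "g ` carrier Y = carrier Z"
    and ex: "f ` carrier X = {y \<in> carrier Y. g y = \<zero>\<^bsub>Z\<^esub>}"
  shows "belongs R S Y"
proof -
  interpret Y: module R Y by fact
  obtain X' h h' where X': "X' \<in> S" "h \<in> mod_hom R X X'" "h' \<in> mod_hom R X' X"
    "\<And>x. x \<in> carrier X \<Longrightarrow> h' (h x) = x" "\<And>x. x \<in> carrier X' \<Longrightarrow> h (h' x) = x"
    using belongsE[OF assms(3,5)] by metis
  obtain Z' k k' where Z': "Z' \<in> S" "k \<in> mod_hom R Z Z'" "k' \<in> mod_hom R Z' Z"
    "\<And>x. x \<in> carrier Z \<Longrightarrow> k' (k x) = x" "\<And>x. x \<in> carrier Z' \<Longrightarrow> k (k' x) = x"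
    using belongsE[OF assms(4,7)] by metis
  have mX': "module R X'" and mZ': "module R Z'"
    using serre_module[OF assms(2)] X'(1) Z'(1) by auto
  obtain e :: "'u \<times> 'u \<Rightarrow> 'u" where e: "inj e" by (rule infinite_pair_injection[OF assms(1)])
  \<comment> \<open>A section of \<open>g\<close>, in general not a homomorphism; it only serves to
    build an injection of sets.\<close>
  define \<sigma> where "\<sigma> = inv_into (carrier Y) g"
  define \<rho> where "\<rho> y = inv_into (carrier X) f (y \<ominus>\<^bsub>Y\<^esub> \<sigma> (g y))" for y
  define j where "j y = e (k (g y), h (\<rho> y))" for y
  have \<sigma>: "\<sigma> (g y) \<in> carrier Y" "g (\<sigma> (g y)) = g y" if "y \<in> carrier Y" for y
    unfolding \<sigma>_def using that by (auto simp: inv_into_into f_inv_into_f)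
  have \<rho>: "\<rho> y \<in> carrier X" "f (\<rho> y) = y \<ominus>\<^bsub>Y\<^esub> \<sigma> (g y)" if "y \<in> carrier Y" for y
  proof -
    have "g (y \<ominus>\<^bsub>Y\<^esub> \<sigma> (g y)) = \<zero>\<^bsub>Z\<^esub>"
      using that \<sigma> mod_hom_closed[OF assms(10)]
      by (simp add: mod_hom_diff[OF assms(6,7,10)] module_diff_zero_iff[OF assms(7)])
    then have "y \<ominus>\<^bsub>Y\<^esub> \<sigma> (g y) \<in> f ` carrier X" using that \<sigma> ex by simp
    then show "\<rho> y \<in> carrier X" "f (\<rho> y) = y \<ominus>\<^bsub>Y\<^esub> \<sigma> (g y)"
      unfolding \<rho>_def by (auto simp: inv_into_into f_inv_into_f)
  qed
  have "inj_on j (carrier Y)"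
  proof (rule inj_onI)
    fix y z assume yz: "y \<in> carrier Y" "z \<in> carrier Y" "j y = j z"
    then have eq: "k (g y) = k (g z)" "h (\<rho> y) = h (\<rho> z)"
      using injD[OF e] unfolding j_def by blast+
    from eq(1) yz have g: "g y = g z" using Z'(4) mod_hom_closed[OF assms(10)] by metis
    from eq(2) yz have "\<rho> y = \<rho> z" using X'(4) \<rho>(1) by metis
    then have "y \<ominus>\<^bsub>Y\<^esub> \<sigma> (g y) = z \<ominus>\<^bsub>Y\<^esub> \<sigma> (g y)" using \<rho>(2) yz g by metis
    then show "y = z" using yz \<sigma> by (simp add: a_minus_def)
  qed
  then obtain Y' where Y': "module R Y'" "j \<in> mod_hom R Y Y'" "bij_betw j (carrier Y) (carrier Y')"
    using module_transport[OF assms(6)] by blast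
  define i where "i = inv_into (carrier Y) j"
  have i: "i \<in> mod_hom R Y' Y" unfolding i_def by (rule mod_hom_inv_into[OF assms(6) Y'(2,3)])
  have ij: "i (j y) = y" if "y \<in> carrier Y" for y
    unfolding i_def using Y'(3) that by (simp add: bij_betw_inv_into_left)
  have ji: "j (i y) = y" if "y \<in> carrier Y'" for y
    unfolding i_def using Y'(3) that by (simp add: bij_betw_inv_into_right)
  \<comment> \<open>Conjugated by the three isomorphisms, the given exact sequence consists of
    modules on \<open>'u\<close>.\<close>
  have f': "(\<lambda>x. j (f (h' x))) \<in> mod_hom R X' Y'"
    by (rule mod_hom_comp[OF mod_hom_comp[OF X'(3) assms(8)] Y'(2)])
  have g': "(\<lambda>y. k (g (i y))) \<in> mod_hom R Y' Z'"
    by (rule mod_hom_comp[OF mod_hom_comp[OF i assms(10)] Z'(2)])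
  have h'_surj: "h' ` carrier X' = carrier X"
    using X'(4) mod_hom_closed[OF X'(2)] mod_hom_closed[OF X'(3)] by force
  have i_surj: "i ` carrier Y' = carrier Y"
    using ij mod_hom_closed[OF Y'(2)] mod_hom_closed[OF i] by force
  have k_surj: "k ` carrier Z = carrier Z'"
    using Z'(5) mod_hom_closed[OF Z'(2)] mod_hom_closed[OF Z'(3)] by force
  have k_zero: "k z = \<zero>\<^bsub>Z'\<^esub> \<longleftrightarrow> z = \<zero>\<^bsub>Z\<^esub>" if "z \<in> carrier Z" for z
    using that Z'(4) mod_hom_zero[OF assms(7) mZ' Z'(2)] mod_hom_zero[OF mZ' assms(7) Z'(3)] by metis
  have "Y' \<in> S"
  proof (rule serre_ext[OF assms(2) X'(1) Z'(1) Y'(1) f' _ g'])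
    show "inj_on (\<lambda>x. j (f (h' x))) (carrier X')"
      using X'(5) mod_hom_closed[OF X'(3)] inj_onD[OF assms(9)] ij mod_hom_closed[OF assms(8)]
      unfolding inj_on_def by metis
    show "(\<lambda>y. k (g (i y))) ` carrier Y' = carrier Z'"
      using i_surj k_surj assms(11) by (metis image_image)
    have "(\<lambda>x. j (f (h' x))) ` carrier X' = j ` {y \<in> carrier Y. g y = \<zero>\<^bsub>Z\<^esub>}"
      using h'_surj ex by (metis image_image)
    also have "\<dots> = {y \<in> carrier Y'. k (g (i y)) = \<zero>\<^bsub>Z'\<^esub>}"
      using ij ji mod_hom_closed[OF Y'(2)] mod_hom_closed[OF i] mod_hom_closed[OF assms(10)]
      by (force simp: k_zero)
    finally show "(\<lambda>x. j (f (h' x))) ` carrier X' = {y \<in> carrier Y'. k (g (i y)) = \<zero>\<^bsub>Z'\<^esub>}" .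
  qed
  then show ?thesis by (rule belongsI[OF _ Y'(2,3)])
qed

section \<open>Finite direct sums and separating families of homomorphisms\<close>

definition direct_sum :: "('r, 'a) module \<Rightarrow> ('r, 'b) module \<Rightarrow> ('r, 'a \<times> 'b) module"
  where "direct_sum X Y =
    \<lparr>carrier = carrier X \<times> carrier Y, monoid.mult = undefined, one = undefined,
     zero = (\<zero>\<^bsub>X\<^esub>, \<zero>\<^bsub>Y\<^esub>), add = (\<lambda>p q. (fst p \<oplus>\<^bsub>X\<^esub> fst q, snd p \<oplus>\<^bsub>Y\<^esub> snd q)),
     smult = (\<lambda>r p. (r \<odot>\<^bsub>X\<^esub> fst p, r \<odot>\<^bsub>Y\<^esub> snd p))\<rparr>"

lemma module_direct_sum:
  assumes "module R X" "module R Y"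
  shows "module R (direct_sum X Y)"
proof -
  interpret X: module R X by fact
  interpret Y: module R Y by fact
  show ?thesis
  proof (rule moduleI)
    show "abelian_group (direct_sum X Y)"
    proof (rule abelian_groupI)
      show "\<exists>q\<in>carrier (direct_sum X Y). q \<oplus>\<^bsub>direct_sum X Y\<^esub> p = \<zero>\<^bsub>direct_sum X Y\<^esub>"
        if "p \<in> carrier (direct_sum X Y)" for p
        using that by (intro bexI[of _ "(\<ominus>\<^bsub>X\<^esub> fst p, \<ominus>\<^bsub>Y\<^esub> snd p)"])
          (auto simp: direct_sum_def X.M.l_neg Y.M.l_neg)
    qed (auto simp: direct_sum_def X.M.a_ac Y.M.a_ac)
  qed (auto simp: direct_sum_def X.is_cring X.smult_l_distr X.smult_r_distr X.smult_assoc1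
      Y.smult_l_distr Y.smult_r_distr Y.smult_assoc1)
qed

lemma belongs_direct_sum:
  fixes S :: "('r, 'u) module set"
  assumes "infinite (UNIV :: 'u set)" "serre_subcategory R S"
    and "belongs R S X" "belongs R S Y" "module R X" "module R Y"
  shows "belongs R S (direct_sum X Y)"
proof -
  interpret X: module R X by fact
  interpret Y: module R Y by fact
  show ?thesis
  proof (rule belongs_ext[OF assms(1-5) module_direct_sum[OF assms(5,6)] assms(6),
        of "\<lambda>x. (x, \<zero>\<^bsub>Y\<^esub>)" snd])
    show "snd ` carrier (direct_sum X Y) = carrier Y"
      using X.M.zero_closed by (auto simp: direct_sum_def)
  qed (auto simp: direct_sum_def intro!: mod_homI inj_onI)
qed

text \<open>The maps \<open>ev a\<close> together send \<open>Z\<close> to a finite power of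
  \<open>M\<close>, and \<open>sep\<close> makes \<open>q\<close> factor through the image of
  \<open>Z\<close> there.\<close>

lemma belongs_of_separating_homs:
  fixes S :: "('r, 'u) module set"
  assumes "infinite (UNIV :: 'u set)" "serre_subcategory R S" "M \<in> S"
    and "module R Z" "module R Q" "q \<in> mod_hom R Z Q" "q ` carrier Z = carrier Q"
    and "finite A" "\<And>a. a \<in> A \<Longrightarrow> ev a \<in> mod_hom R Z M"
    and sep: "\<And>z. \<lbrakk>z \<in> carrier Z; \<And>a. a \<in> A \<Longrightarrow> ev a z = \<zero>\<^bsub>M\<^esub>\<rbrakk> \<Longrightarrow> q z = \<zero>\<^bsub>Q\<^esub>"
  shows "belongs R S Q"
proof -
  have mM: "module R M" by (rule serre_module[OF assms(2,3)])
  interpret M: module R M by fact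
  \<comment> \<open>\<open>P\<close> stands for a power of \<open>M\<close>, but only the kernel of
    \<open>p\<close> is recorded: each induction step replaces the sum of \<open>P\<close> and
    \<open>M\<close> by an isomorphic module on \<open>'u\<close>.\<close>
  have "\<exists>P\<in>S. \<exists>p\<in>mod_hom R Z P. \<forall>z\<in>carrier Z. p z = \<zero>\<^bsub>P\<^esub> \<longleftrightarrow> (\<forall>a\<in>A. ev a z = \<zero>\<^bsub>M\<^esub>)"
    using assms(8,9)
  proof (induction A rule: finite_induct)
    case empty
    \<comment> \<open>With no conditions the joint kernel is all of \<open>Z\<close>; the zero map
      into \<open>M\<close> realizes this inside \<open>S\<close>.\<close>
    have "(\<lambda>z. \<zero>\<^bsub>M\<^esub>) \<in> mod_hom R Z M" by (rule mod_homI) auto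
    then show ?case
      by (intro bexI[OF _ assms(3)] bexI[of _ "\<lambda>z. \<zero>\<^bsub>M\<^esub>"]) simp
  next
    case (insert a A)
    have "\<exists>P\<in>S. \<exists>p\<in>mod_hom R Z P. \<forall>z\<in>carrier Z. p z = \<zero>\<^bsub>P\<^esub> \<longleftrightarrow> (\<forall>a\<in>A. ev a z = \<zero>\<^bsub>M\<^esub>)"
      by (rule insert.IH) (rule insert.prems, simp)
    then obtain P p where P: "P \<in> S" "p \<in> mod_hom R Z P"
      "\<And>z. z \<in> carrier Z \<Longrightarrow> p z = \<zero>\<^bsub>P\<^esub> \<longleftrightarrow> (\<forall>a\<in>A. ev a z = \<zero>\<^bsub>M\<^esub>)"
      by blast
    have eva: "ev a \<in> mod_hom R Z M" using insert.prems by simp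
    have mP: "module R P" by (rule serre_module[OF assms(2) P(1)])
    let ?D = "direct_sum P M"
    have mD: "module R ?D" by (rule module_direct_sum[OF mP mM])
    have "belongs R S ?D"
      by (rule belongs_direct_sum[OF assms(1,2) belongs_member[OF P(1)] belongs_member[OF assms(3)] mP mM])
    then obtain D' h h' where D': "D' \<in> S" "h \<in> mod_hom R ?D D'" "h' \<in> mod_hom R D' ?D"
      "\<And>x. x \<in> carrier ?D \<Longrightarrow> h' (h x) = x"
      using belongsE[OF _ mD] by metis
    have mD': "module R D'" by (rule serre_module[OF assms(2) D'(1)])
    have pair: "(\<lambda>z. (p z, ev a z)) \<in> mod_hom R Z ?D"
      using P(2) eva by (intro mod_homI)
        (auto simp: direct_sum_def mod_hom_closed mod_hom_add mod_hom_smult)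
    have "h (p z, ev a z) = \<zero>\<^bsub>D'\<^esub> \<longleftrightarrow> (\<forall>b\<in>insert a A. ev b z = \<zero>\<^bsub>M\<^esub>)" if "z \<in> carrier Z" for z
    proof -
      have "h (p z, ev a z) = \<zero>\<^bsub>D'\<^esub> \<longleftrightarrow> (p z, ev a z) = \<zero>\<^bsub>?D\<^esub>"
        using D'(4)[OF mod_hom_closed[OF pair that]]
          mod_hom_zero[OF mD mD' D'(2)] mod_hom_zero[OF mD' mD D'(3)] by metis
      then show ?thesis using P(3)[OF that] by (auto simp: direct_sum_def)
    qed
    then show ?case
      by (intro bexI[OF _ D'(1)] bexI[OF _ mod_hom_comp[OF pair D'(2)]] ballI)
  qed
  then obtain P p where P: "P \<in> S" "p \<in> mod_hom R Z P"
    "\<And>z. z \<in> carrier Z \<Longrightarrow> p z = \<zero>\<^bsub>P\<^esub> \<longleftrightarrow> (\<forall>a\<in>A. ev a z = \<zero>\<^bsub>M\<^esub>)"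
    by blast
  have mP: "module R P" by (rule serre_module[OF assms(2) P(1)])
  have ker: "q z = \<zero>\<^bsub>Q\<^esub>" if "z \<in> carrier Z" "p z = \<zero>\<^bsub>P\<^esub>" for z
    using that P(3) sep by blast
  obtain g where g: "g \<in> mod_hom R (P\<lparr>carrier := p ` carrier Z\<rparr>) Q"
    "\<And>z. z \<in> carrier Z \<Longrightarrow> g (p z) = q z"
    using mod_hom_factor[OF assms(4) mP assms(5) P(2) assms(6) ker] by blast
  have sub: "submodule (p ` carrier Z) R P"
    by (rule submodule_image[OF assms(4) mP P(2) submodule_carrier[OF assms(4)]])
  have mI: "module R (P\<lparr>carrier := p ` carrier Z\<rparr>)" by (rule submodule_module[OF mP sub])
  have "P\<lparr>carrier := p ` carrier Z\<rparr> \<in> S"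
    by (rule serre_sub[OF assms(2) P(1) mI mod_hom_restrict_domain[OF mod_hom_id sub]]) auto
  then show ?thesis
    by (rule belongs_quot[OF assms(2) belongs_member mI assms(5) g(1)])
       (simp add: image_image g(2) assms(7) cong: image_cong)
qed

section \<open>The module structure of Ext\<close>

lemma hom_module_simps:
  "carrier (hom_module R X Y) = mod_hom R X Y \<inter> extensional (carrier X)"
  "\<zero>\<^bsub>hom_module R X Y\<^esub> = (\<lambda>x\<in>carrier X. \<zero>\<^bsub>Y\<^esub>)"
  "f \<oplus>\<^bsub>hom_module R X Y\<^esub> g = (\<lambda>x\<in>carrier X. f x \<oplus>\<^bsub>Y\<^esub> g x)"
  "r \<odot>\<^bsub>hom_module R X Y\<^esub> f = (\<lambda>x\<in>carrier X. r \<odot>\<^bsub>Y\<^esub> f x)"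
  by (simp_all add: hom_module_def)

text \<open>Elements of \<open>hom_module\<close> are extensional functions. Linearity ignores this
  truncation because the operations of \<open>X\<close> stay in its carrier.\<close>

lemma mod_hom_restrict_iff:
  assumes "module R X"
  shows "restrict f (carrier X) \<in> mod_hom R X Y \<longleftrightarrow> f \<in> mod_hom R X Y"
proof -
  interpret X: module R X by fact
  show ?thesis by (simp add: mod_hom_def Pi_iff)
qed

lemma module_hom_module:
  assumes "module R X" "module R Y"
  shows "module R (hom_module R X Y)"
proof -
  interpret X: module R X by fact
  interpret Y: module R Y by fact
  let ?H = "hom_module R X Y"
  note restr = mod_hom_restrict_iff[OF assms(1)]
  have add: "(\<lambda>x. f x \<oplus>\<^bsub>Y\<^esub> g x) \<in> mod_hom R X Y" if "f \<in> mod_hom R X Y" "g \<in> mod_hom R X Y" for f g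
    using that by (intro mod_homI)
      (auto simp: mod_hom_closed mod_hom_add mod_hom_smult Y.smult_r_distr Y.M.a_ac)
  have smult: "(\<lambda>x. r \<odot>\<^bsub>Y\<^esub> f x) \<in> mod_hom R X Y" if "r \<in> carrier R" "f \<in> mod_hom R X Y" for r f
    using that by (intro mod_homI)
      (auto simp: mod_hom_closed mod_hom_add mod_hom_smult Y.smult_r_distr X.m_comm
        simp flip: Y.smult_assoc1)
  have zero: "(\<lambda>x. \<zero>\<^bsub>Y\<^esub>) \<in> mod_hom R X Y" by (rule mod_homI) auto
  note ext = extensionalityI[of _ "carrier X"]
  note cl = mod_hom_closed[of _ R X Y]
  show ?thesis
  proof (rule moduleI)
    show "abelian_group ?H"
    proof (rule abelian_groupI)
      fix f g h assume f: "f \<in> carrier ?H" and g: "g \<in> carrier ?H" and h: "h \<in> carrier ?H"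
      show "f \<oplus>\<^bsub>?H\<^esub> g \<in> carrier ?H"
        using f g by (simp add: hom_module_simps restr add)
      show "f \<oplus>\<^bsub>?H\<^esub> g \<oplus>\<^bsub>?H\<^esub> h = f \<oplus>\<^bsub>?H\<^esub> (g \<oplus>\<^bsub>?H\<^esub> h)"
        using f g h by (intro ext) (simp_all add: hom_module_simps cl Y.M.a_assoc)
      show "f \<oplus>\<^bsub>?H\<^esub> g = g \<oplus>\<^bsub>?H\<^esub> f"
        using f g by (intro ext) (simp_all add: hom_module_simps cl Y.M.a_comm)
      show "\<zero>\<^bsub>?H\<^esub> \<oplus>\<^bsub>?H\<^esub> f = f"
        using f by (intro ext) (simp_all add: hom_module_simps cl)
      show "\<exists>f'\<in>carrier ?H. f' \<oplus>\<^bsub>?H\<^esub> f = \<zero>\<^bsub>?H\<^esub>"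
      proof (intro bexI)
        show "((\<ominus>\<^bsub>R\<^esub> \<one>\<^bsub>R\<^esub>) \<odot>\<^bsub>?H\<^esub> f) \<oplus>\<^bsub>?H\<^esub> f = \<zero>\<^bsub>?H\<^esub>"
          using f by (intro ext)
            (simp_all add: hom_module_simps cl Y.M.l_neg flip: module_minus_eq[OF assms(2)])
        show "(\<ominus>\<^bsub>R\<^esub> \<one>\<^bsub>R\<^esub>) \<odot>\<^bsub>?H\<^esub> f \<in> carrier ?H"
          using f by (simp add: hom_module_simps restr smult)
      qed
    qed (simp add: hom_module_simps restr zero)
  next
    fix r s f g assume r: "r \<in> carrier R" and s: "s \<in> carrier R"
      and f: "f \<in> carrier ?H" and g: "g \<in> carrier ?H"
    show "r \<odot>\<^bsub>?H\<^esub> f \<in> carrier ?H"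
      using r f by (simp add: hom_module_simps restr smult)
    show "(r \<oplus>\<^bsub>R\<^esub> s) \<odot>\<^bsub>?H\<^esub> f = r \<odot>\<^bsub>?H\<^esub> f \<oplus>\<^bsub>?H\<^esub> s \<odot>\<^bsub>?H\<^esub> f"
      using r s f by (intro ext) (simp_all add: hom_module_simps cl Y.smult_l_distr)
    show "r \<odot>\<^bsub>?H\<^esub> (f \<oplus>\<^bsub>?H\<^esub> g) = r \<odot>\<^bsub>?H\<^esub> f \<oplus>\<^bsub>?H\<^esub> r \<odot>\<^bsub>?H\<^esub> g"
      using r f g by (intro ext) (simp_all add: hom_module_simps cl Y.smult_r_distr)
    show "(r \<otimes>\<^bsub>R\<^esub> s) \<odot>\<^bsub>?H\<^esub> f = r \<odot>\<^bsub>?H\<^esub> (s \<odot>\<^bsub>?H\<^esub> f)"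
      using r s f by (intro ext) (simp_all add: hom_module_simps cl Y.smult_assoc1)
  next
    fix f assume f: "f \<in> carrier ?H"
    show "\<one>\<^bsub>R\<^esub> \<odot>\<^bsub>?H\<^esub> f = f"
      using f by (intro ext) (simp_all add: hom_module_simps cl)
  qed (rule X.is_cring)
qed

lemma hom_module_precomp:
  assumes "module R W" "d \<in> mod_hom R W X"
  shows "(\<lambda>f. \<lambda>x\<in>carrier W. f (d x)) \<in> mod_hom R (hom_module R X Y) (hom_module R W Y)"
  using mod_hom_comp[OF assms(2), where Z = Y] mod_hom_closed[OF assms(2)]
  by (intro mod_homI) (auto simp: hom_module_simps mod_hom_restrict_iff[OF assms(1)])

text \<open>This is the kernel of precomposition with \<open>d i\<close>, once the pointwise
  condition is read as equality with the extensional zero function.\<close>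

lemma submodule_hom_cocycles:
  assumes "\<And>i. module R (F i)" "\<And>i. d i \<in> mod_hom R (F (Suc i)) (F i)" "module R Y"
  shows "submodule (hom_cocycles R F d Y i) R (hom_module R (F i) Y)"
proof -
  interpret Y: module R Y by fact
  note cl = mod_hom_closed[OF assms(2)]
  have "submodule {f \<in> carrier (hom_module R (F i) Y).
      (\<lambda>x\<in>carrier (F (Suc i)). f (d i x)) = \<zero>\<^bsub>hom_module R (F (Suc i)) Y\<^esub>} R (hom_module R (F i) Y)"
    by (rule submodule_kernel[OF module_hom_module[OF assms(1,3)] module_hom_module[OF assms(1,3)]
          hom_module_precomp[OF assms(1,2)]])
  also have "{f \<in> carrier (hom_module R (F i) Y).
      (\<lambda>x\<in>carrier (F (Suc i)). f (d i x)) = \<zero>\<^bsub>hom_module R (F (Suc i)) Y\<^esub>} = hom_cocycles R F d Y i"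
    by (auto simp: hom_cocycles_def hom_module_simps fun_eq_iff restrict_def)
  finally show ?thesis .
qed

text \<open>Coboundaries form a submodule of the full Hom module, being zero or an image;
  \<open>dd\<close> places them among the cocycles.\<close>

lemma submodule_hom_coboundaries:
  assumes "\<And>i. module R (F i)" "\<And>i. d i \<in> mod_hom R (F (Suc i)) (F i)" "module R Y"
    and dd: "\<And>i x. x \<in> carrier (F (Suc (Suc i))) \<Longrightarrow> d i (d (Suc i) x) = \<zero>\<^bsub>F i\<^esub>"
  shows "submodule (hom_coboundaries R F d Y i) R
    ((hom_module R (F i) Y)\<lparr>carrier := hom_cocycles R F d Y i\<rparr>)"
proof -
  note hm = module_hom_module[OF assms(1,3)]
  note mZ = submodule_module[OF hm submodule_hom_cocycles[where F = F and d = d, OF assms(1-3)]]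
  have sub: "submodule (hom_coboundaries R F d Y i) R (hom_module R (F i) Y)"
  proof (cases i)
    case 0
    interpret H: module R "hom_module R (F 0) Y" by (rule hm)
    show ?thesis using 0 by (auto intro!: submodule_intro[OF hm])
  next
    case (Suc j)
    show ?thesis
      using submodule_image[OF hm hm hom_module_precomp[OF assms(1,2)] submodule_carrier[OF hm]]
      by (simp add: Suc)
  qed
  have "hom_coboundaries R F d Y i \<subseteq> hom_cocycles R F d Y i"
  proof (cases i)
    case 0
    then show ?thesis
      using submodule_zero[OF submodule_hom_cocycles[where F = F and d = d and i = 0, OF assms(1-3)]] by simp
  next
    case (Suc j)
    have "f \<in> hom_cocycles R F d Y i" if "f \<in> hom_coboundaries R F d Y i" for f
    proof -
      from that obtain c where c: "c \<in> carrier (hom_module R (F j) Y)"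
        "f = (\<lambda>x\<in>carrier (F (Suc j)). c (d j x))" by (auto simp: Suc)
      have "c \<zero>\<^bsub>F j\<^esub> = \<zero>\<^bsub>Y\<^esub>"
        using c(1) by (intro mod_hom_zero[OF assms(1,3)]) (simp add: hom_module_simps)
      then show ?thesis
        using submodule_subset[OF sub] that c(2) mod_hom_closed[OF assms(2)]
        by (auto simp: hom_cocycles_def Suc dd)
    qed
    then show ?thesis by blast
  qed
  then show ?thesis
    using sub by (intro submodule_intro[OF mZ])
      (auto simp: submodule_zero submodule_add submodule_smult)
qed

section \<open>Finitely generated submodules over noetherian rings\<close>

definition mod_span :: "('r, 'x) ring_scheme \<Rightarrow> ('r, 'a) module \<Rightarrow> 'a set \<Rightarrow> 'a set"
  where "mod_span R X A = \<Inter>{H. submodule H R X \<and> A \<subseteq> H}"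

lemma mod_span_minimal: "\<lbrakk>submodule H R X; A \<subseteq> H\<rbrakk> \<Longrightarrow> mod_span R X A \<subseteq> H"
  unfolding mod_span_def by blast

lemma mod_span_incl: "A \<subseteq> mod_span R X A"
  unfolding mod_span_def by blast

lemma submodule_mod_span:
  assumes "module R X" "A \<subseteq> carrier X"
  shows "submodule (mod_span R X A) R X"
proof (rule submodule_intro[OF assms(1)])
  show "mod_span R X A \<subseteq> carrier X"
    by (rule mod_span_minimal[OF submodule_carrier[OF assms(1)] assms(2)])
qed (auto simp: mod_span_def submodule_zero submodule_add submodule_smult)

text \<open>The sums of a multiple of \<open>a\<close> and an element of the smaller span already
  form a submodule containing all generators.\<close>

lemma mod_span_insert:
  assumes "module R X" "a \<in> carrier X" "A \<subseteq> carrier X" "x \<in> mod_span R X (insert a A)"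
  obtains r y where "r \<in> carrier R" "y \<in> mod_span R X A" "x = r \<odot>\<^bsub>X\<^esub> a \<oplus>\<^bsub>X\<^esub> y"
proof -
  interpret X: module R X by fact
  let ?K = "mod_span R X A"
  let ?H = "{r \<odot>\<^bsub>X\<^esub> a \<oplus>\<^bsub>X\<^esub> y | r y. r \<in> carrier R \<and> y \<in> ?K}"
  have K: "submodule ?K R X" by (rule submodule_mod_span[OF assms(1,3)])
  note Kc = submodule_subset[OF K, THEN subsetD]
  have "submodule ?H R X"
  proof (rule submodule_intro[OF assms(1)])
    show "?H \<subseteq> carrier X" using Kc assms(2) by auto
    have "\<zero>\<^bsub>X\<^esub> = \<zero>\<^bsub>R\<^esub> \<odot>\<^bsub>X\<^esub> a \<oplus>\<^bsub>X\<^esub> \<zero>\<^bsub>X\<^esub>" using assms(2) by simp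
    then show "\<zero>\<^bsub>X\<^esub> \<in> ?H" using submodule_zero[OF K] X.R.zero_closed by blast
  next
    fix x z assume "x \<in> ?H" "z \<in> ?H"
    then obtain r y s w where *: "r \<in> carrier R" "y \<in> ?K" "x = r \<odot>\<^bsub>X\<^esub> a \<oplus>\<^bsub>X\<^esub> y"
      "s \<in> carrier R" "w \<in> ?K" "z = s \<odot>\<^bsub>X\<^esub> a \<oplus>\<^bsub>X\<^esub> w" by blast
    then have "x \<oplus>\<^bsub>X\<^esub> z = (r \<oplus>\<^bsub>R\<^esub> s) \<odot>\<^bsub>X\<^esub> a \<oplus>\<^bsub>X\<^esub> (y \<oplus>\<^bsub>X\<^esub> w)"
      using Kc assms(2) by (simp add: X.smult_l_distr X.M.a_ac)
    then show "x \<oplus>\<^bsub>X\<^esub> z \<in> ?H"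
      using * submodule_add[OF K] X.R.a_closed by blast
  next
    fix s x assume s: "s \<in> carrier R" and "x \<in> ?H"
    then obtain r y where *: "r \<in> carrier R" "y \<in> ?K" "x = r \<odot>\<^bsub>X\<^esub> a \<oplus>\<^bsub>X\<^esub> y" by blast
    then have "s \<odot>\<^bsub>X\<^esub> x = (s \<otimes>\<^bsub>R\<^esub> r) \<odot>\<^bsub>X\<^esub> a \<oplus>\<^bsub>X\<^esub> s \<odot>\<^bsub>X\<^esub> y"
      using Kc assms(2) s by (simp add: X.smult_r_distr X.smult_assoc1)
    then show "s \<odot>\<^bsub>X\<^esub> x \<in> ?H"
      using * s submodule_smult[OF K] X.R.m_closed by blast
  qed
  moreover have "insert a A \<subseteq> ?H"
  proof -
    have "a = \<one>\<^bsub>R\<^esub> \<odot>\<^bsub>X\<^esub> a \<oplus>\<^bsub>X\<^esub> \<zero>\<^bsub>X\<^esub>" using assms(2) by simp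
    then have "a \<in> ?H" using submodule_zero[OF K] X.R.one_closed by blast
    moreover have "b \<in> ?H" if "b \<in> A" for b
    proof -
      have "b = \<zero>\<^bsub>R\<^esub> \<odot>\<^bsub>X\<^esub> a \<oplus>\<^bsub>X\<^esub> b" using that assms(2,3) by auto
      then show ?thesis using that mod_span_incl[of A] X.R.zero_closed by blast
    qed
    ultimately show ?thesis by blast
  qed
  ultimately have "x \<in> ?H" using mod_span_minimal assms(4) by blast
  then show ?thesis using that by blast
qed

lemma ideal_intro:
  assumes "cring R" "J \<subseteq> carrier R" "\<zero>\<^bsub>R\<^esub> \<in> J"
    and "\<And>x y. \<lbrakk>x \<in> J; y \<in> J\<rbrakk> \<Longrightarrow> x \<oplus>\<^bsub>R\<^esub> y \<in> J"
    and "\<And>r x. \<lbrakk>r \<in> carrier R; x \<in> J\<rbrakk> \<Longrightarrow> r \<otimes>\<^bsub>R\<^esub> x \<in> J"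
  shows "ideal J R"
proof -
  interpret cring R by fact
  have "subgroup J (add_monoid R)"
  proof (rule add.subgroupI)
    fix x assume x: "x \<in> J"
    then have "\<ominus>\<^bsub>R\<^esub> x = (\<ominus>\<^bsub>R\<^esub> \<one>\<^bsub>R\<^esub>) \<otimes>\<^bsub>R\<^esub> x" using assms(2) by (auto simp: l_minus)
    then show "\<ominus>\<^bsub>R\<^esub> x \<in> J" using x assms(5) by simp
  qed (use assms in auto)
  moreover have "x \<otimes>\<^bsub>R\<^esub> r \<in> J" if "r \<in> carrier R" "x \<in> J" for r x
    using that assms(2) assms(5)[OF that] m_comm[of x r] by auto
  ultimately show ?thesis
    using assms(5) by (intro idealI) (auto simp: ring_axioms)
qed

text \<open>The analogue of an ideal of leading coefficients: the coefficients with which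
  \<open>a\<close> occurs in \<open>H\<close> modulo \<open>K\<close>. It lets finite generation
  pass from ideals to modules.\<close>

lemma ideal_coefficients:
  assumes "module R X" "a \<in> carrier X" "submodule H R X" "submodule K R X"
  shows "ideal {r \<in> carrier R. \<exists>y\<in>K. r \<odot>\<^bsub>X\<^esub> a \<oplus>\<^bsub>X\<^esub> y \<in> H} R" (is "ideal ?J R")
proof -
  interpret X: module R X by fact
  note Kc = submodule_subset[OF assms(4), THEN subsetD]
  show ?thesis
  proof (rule ideal_intro[OF X.is_cring])
    show "\<zero>\<^bsub>R\<^esub> \<in> ?J"
      using assms(2) submodule_zero[OF assms(3)] submodule_zero[OF assms(4)]
      by (auto intro!: bexI[of _ "\<zero>\<^bsub>X\<^esub>"])
  next
    fix r s assume "r \<in> ?J" "s \<in> ?J"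
    then obtain y z where *: "r \<in> carrier R" "y \<in> K" "r \<odot>\<^bsub>X\<^esub> a \<oplus>\<^bsub>X\<^esub> y \<in> H"
      "s \<in> carrier R" "z \<in> K" "s \<odot>\<^bsub>X\<^esub> a \<oplus>\<^bsub>X\<^esub> z \<in> H" by blast
    have "(r \<oplus>\<^bsub>R\<^esub> s) \<odot>\<^bsub>X\<^esub> a \<oplus>\<^bsub>X\<^esub> (y \<oplus>\<^bsub>X\<^esub> z) = (r \<odot>\<^bsub>X\<^esub> a \<oplus>\<^bsub>X\<^esub> y) \<oplus>\<^bsub>X\<^esub> (s \<odot>\<^bsub>X\<^esub> a \<oplus>\<^bsub>X\<^esub> z)"
      using * Kc assms(2) by (simp add: X.smult_l_distr X.M.a_ac)
    then have "(r \<oplus>\<^bsub>R\<^esub> s) \<odot>\<^bsub>X\<^esub> a \<oplus>\<^bsub>X\<^esub> (y \<oplus>\<^bsub>X\<^esub> z) \<in> H"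
      using * submodule_add[OF assms(3)] by simp
    then show "r \<oplus>\<^bsub>R\<^esub> s \<in> ?J" using * submodule_add[OF assms(4)] by blast
  next
    fix s r assume s: "s \<in> carrier R" and "r \<in> ?J"
    then obtain y where *: "r \<in> carrier R" "y \<in> K" "r \<odot>\<^bsub>X\<^esub> a \<oplus>\<^bsub>X\<^esub> y \<in> H" by blast
    have "(s \<otimes>\<^bsub>R\<^esub> r) \<odot>\<^bsub>X\<^esub> a \<oplus>\<^bsub>X\<^esub> s \<odot>\<^bsub>X\<^esub> y = s \<odot>\<^bsub>X\<^esub> (r \<odot>\<^bsub>X\<^esub> a \<oplus>\<^bsub>X\<^esub> y)"
      using * s Kc assms(2) by (simp add: X.smult_r_distr X.smult_assoc1)
    then have "(s \<otimes>\<^bsub>R\<^esub> r) \<odot>\<^bsub>X\<^esub> a \<oplus>\<^bsub>X\<^esub> s \<odot>\<^bsub>X\<^esub> y \<in> H"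
      using * s submodule_smult[OF assms(3)] by simp
    then show "s \<otimes>\<^bsub>R\<^esub> r \<in> ?J" using * s submodule_smult[OF assms(4)] by blast
  qed auto
qed

text \<open>Induction on the generators of the ambient span. Modulo the span of \<open>A\<close>,
  elements of \<open>D\<close> are multiples of \<open>a\<close> whose coefficients form a finitely
  generated ideal; what remains of \<open>D\<close> lies in the smaller span, where the induction
  hypothesis applies.\<close>

lemma noetherian_submodule_fin_gen:
  assumes "noetherian_ring R" "module R X" "finite A" "A \<subseteq> carrier X"
    and "submodule D R X" "D \<subseteq> mod_span R X A"
  shows "\<exists>B. finite B \<and> B \<subseteq> D \<and> D \<subseteq> mod_span R X B"
  using assms(3-)
proof (induction A arbitrary: D rule: finite_induct)
  case empty
  interpret X: module R X by fact
  have "submodule {\<zero>\<^bsub>X\<^esub>} R X" by (rule submodule_intro[OF assms(2)]) auto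
  then have "mod_span R X {} \<subseteq> {\<zero>\<^bsub>X\<^esub>}" by (rule mod_span_minimal) simp
  moreover have "\<zero>\<^bsub>X\<^esub> \<in> mod_span R X {}"
    by (rule submodule_zero[OF submodule_mod_span[OF assms(2)]]) simp
  ultimately show ?case using empty.prems by blast
next
  case (insert a A)
  interpret X: module R X by fact
  interpret noetherian_ring R by fact
  have a: "a \<in> carrier X" and A: "A \<subseteq> carrier X" using insert.prems by auto
  note D = insert.prems(2)
  note Dc = submodule_subset[OF D, THEN subsetD]
  let ?K = "mod_span R X A"
  have K: "submodule ?K R X" by (rule submodule_mod_span[OF assms(2) A])
  note Kc = submodule_subset[OF K, THEN subsetD]
  let ?J = "\<lambda>H. {r \<in> carrier R. \<exists>y\<in>?K. r \<odot>\<^bsub>X\<^esub> a \<oplus>\<^bsub>X\<^esub> y \<in> H}"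
  obtain G where G: "G \<subseteq> carrier R" "finite G" "?J D = Idl\<^bsub>R\<^esub> G"
    using finetely_gen[OF ideal_coefficients[OF assms(2) a D K]] by blast
  have "G \<subseteq> ?J D" using X.R.genideal_self[OF G(1)] G(3) by simp
  then have "\<forall>r\<in>G. \<exists>y. y \<in> ?K \<and> r \<odot>\<^bsub>X\<^esub> a \<oplus>\<^bsub>X\<^esub> y \<in> D" by blast
  from bchoice[OF this] obtain y
    where y': "\<forall>r\<in>G. y r \<in> ?K \<and> r \<odot>\<^bsub>X\<^esub> a \<oplus>\<^bsub>X\<^esub> y r \<in> D" ..
  note y = y'[THEN bspec, THEN conjunct1] y'[THEN bspec, THEN conjunct2]
  have "submodule (D \<inter> ?K) R X" by (rule submodule_Int[OF assms(2) D K])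
  from insert.IH[OF A this Int_lower2]
  obtain B where B: "finite B" "B \<subseteq> D \<inter> ?K" "D \<inter> ?K \<subseteq> mod_span R X B" by blast
  \<comment> \<open>Lifts to \<open>D\<close> of generators of the coefficient ideal, together with
    generators of \<open>D \<inter> ?K\<close>.\<close>
  let ?B = "(\<lambda>r. r \<odot>\<^bsub>X\<^esub> a \<oplus>\<^bsub>X\<^esub> y r) ` G \<union> B"
  let ?H = "mod_span R X ?B"
  have BD: "?B \<subseteq> D" using y(2) B(2) by blast
  then have BX: "?B \<subseteq> carrier X" using Dc by blast
  have H: "submodule ?H R X" by (rule submodule_mod_span[OF assms(2) BX])
  have HD: "?H \<subseteq> D" by (rule mod_span_minimal[OF D BD])
  have BH: "mod_span R X B \<subseteq> ?H" by (rule mod_span_minimal[OF H]) (use mod_span_incl[of ?B] in blast)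
  have "G \<subseteq> ?J ?H"
  proof
    fix r assume "r \<in> G"
    then have "r \<odot>\<^bsub>X\<^esub> a \<oplus>\<^bsub>X\<^esub> y r \<in> ?H" using mod_span_incl[of ?B R X] by blast
    then show "r \<in> ?J ?H" using \<open>r \<in> G\<close> G(1) y(1) by blast
  qed
  then have J: "?J D \<subseteq> ?J ?H"
    using X.R.genideal_minimal[OF ideal_coefficients[OF assms(2) a H K]] G(3) by simp
  have "D \<subseteq> ?H"
  proof
    fix x assume x: "x \<in> D"
    then have "x \<in> mod_span R X (insert a A)" using insert.prems(3) by blast
    then obtain r z where rz: "r \<in> carrier R" "z \<in> ?K" "x = r \<odot>\<^bsub>X\<^esub> a \<oplus>\<^bsub>X\<^esub> z"
      using mod_span_insert[OF assms(2) a A] by blast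
    then have "r \<in> ?J D" using x by blast
    then obtain w where w: "w \<in> ?K" "r \<odot>\<^bsub>X\<^esub> a \<oplus>\<^bsub>X\<^esub> w \<in> ?H" using J by blast
    \<comment> \<open>Subtracting an element of \<open>?H\<close> with the same coefficient at
      \<open>a\<close> leaves an element of \<open>D \<inter> ?K\<close>, which the span of
      \<open>B\<close> contains.\<close>
    have "x \<ominus>\<^bsub>X\<^esub> (r \<odot>\<^bsub>X\<^esub> a \<oplus>\<^bsub>X\<^esub> w) = (r \<odot>\<^bsub>X\<^esub> a \<ominus>\<^bsub>X\<^esub> r \<odot>\<^bsub>X\<^esub> a) \<oplus>\<^bsub>X\<^esub> (z \<ominus>\<^bsub>X\<^esub> w)"
      using rz w(1) a Kc by (simp add: a_minus_def X.M.minus_add X.M.a_ac)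
    also have "\<dots> = z \<ominus>\<^bsub>X\<^esub> w"
      using rz w(1) a Kc by (simp add: a_minus_def X.M.r_neg)
    finally have eq: "x \<ominus>\<^bsub>X\<^esub> (r \<odot>\<^bsub>X\<^esub> a \<oplus>\<^bsub>X\<^esub> w) = z \<ominus>\<^bsub>X\<^esub> w" .
    have "z \<ominus>\<^bsub>X\<^esub> w \<in> D"
      using submodule_diff[OF assms(2) D x] w(2) HD eq by (metis subsetD)
    moreover have "z \<ominus>\<^bsub>X\<^esub> w \<in> ?K" by (rule submodule_diff[OF assms(2) K rz(2) w(1)])
    ultimately have "x \<ominus>\<^bsub>X\<^esub> (r \<odot>\<^bsub>X\<^esub> a \<oplus>\<^bsub>X\<^esub> w) \<in> ?H" using B(3) BH eq by auto
    from submodule_add[OF H this w(2)] show "x \<in> ?H"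
      using Dc[OF x] rz w(1) a Kc by (simp add: a_minus_def X.M.a_assoc X.M.l_neg)
  qed
  then show ?case using BD G(2) B(1) by (intro exI[of _ ?B]) auto
qed

section \<open>A finite approximation of the standard resolution\<close>

text \<open>\<open>lin_ext_basis\<close> only yields an unnamed preimage of \<open>\<phi> g\<close>;
  the lifting below evaluates maps at a specific basis vector.\<close>

definition std_basis :: "('r, 'x) ring_scheme \<Rightarrow> 'g \<Rightarrow> 'g \<Rightarrow> 'r"
  where "std_basis R g = (\<lambda>h. if h = g then \<one>\<^bsub>R\<^esub> else \<zero>\<^bsub>R\<^esub>)"

lemma std_basis_closed:
  assumes "cring R" "g \<in> G"
  shows "std_basis R g \<in> carrier (free_module R G)"
proof -
  interpret cring R by fact
  show ?thesis using assms(2) by (auto simp: free_module_carrier_iff std_basis_def)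
qed

lemma lin_ext_std_basis:
  assumes "module R X" "\<phi> \<in> G \<rightarrow> carrier X" "g \<in> G"
  shows "lin_ext R X \<phi> (std_basis R g) = \<phi> g"
proof -
  interpret module R X by fact
  have "lin_ext R X \<phi> (std_basis R g) = (\<Oplus>\<^bsub>X\<^esub>h\<in>{g}. std_basis R g h \<odot>\<^bsub>X\<^esub> \<phi> h)"
    by (rule lin_ext_superset[OF assms(1) std_basis_closed[OF R.is_cring assms(3)] assms(2)])
       (use assms(3) in \<open>auto simp: std_basis_def\<close>)
  also have "\<dots> = \<phi> g" using assms by (simp add: Pi_iff std_basis_def)
  finally show ?thesis .
qed

text \<open>The formal expressions that name relations double as an induction principle: every
  element is the value of a finite list, built up from basis vectors by scaling and adding.\<close>

lemma free_module_eq_if_basis: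
  assumes "cring R" "submodule H R (free_module R G)" "\<And>g. g \<in> G \<Longrightarrow> std_basis R g \<in> H"
  shows "carrier (free_module R G) \<subseteq> H"
proof
  interpret cring R by fact
  fix f assume "f \<in> carrier (free_module R G)"
  then obtain ps where "set ps \<subseteq> carrier R \<times> G" "expr_value R ps = f"
    by (rule expr_value_onto[OF assms(1)])
  moreover have "expr_value R ps \<in> H" if "set ps \<subseteq> carrier R \<times> G" for ps
    using that
  proof (induction ps)
    case Nil
    show ?case using submodule_zero[OF assms(2)] by (simp add: free_module_simps)
  next
    case (Cons p ps)
    then have p: "fst p \<in> carrier R" "snd p \<in> G" and IH: "expr_value R ps \<in> H" by auto
    have "expr_value R (p # ps) =
        (fst p \<odot>\<^bsub>free_module R G\<^esub> std_basis R (snd p)) \<oplus>\<^bsub>free_module R G\<^esub> expr_value R ps"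
      using p by (auto simp: free_module_simps std_basis_def fun_eq_iff)
    then show ?case
      using submodule_add[OF assms(2) submodule_smult[OF assms(2) p(1) assms(3)[OF p(2)]] IH] by simp
  qed
  ultimately show "f \<in> H" by blast
qed

text \<open>One step in building the homotopy. As \<open>e (w f)\<close> stays in a finitely
  generated submodule, \<open>w f\<close> agrees modulo the kernel of \<open>e\<close> with an
  element of a fixed finitely generated span. Exactness puts the difference in the image of
  \<open>d\<close>, and freeness lets preimages be chosen linearly.\<close>

lemma lift_modulo_fin_gen:
  assumes "noetherian_ring R" "module R Y" "module R F'"
    and d: "d \<in> mod_hom R F' (free_module R G)" and e: "e \<in> mod_hom R (free_module R G) Y"
    and exact: "{f \<in> carrier (free_module R G). e f = \<zero>\<^bsub>Y\<^esub>} \<subseteq> d ` carrier F'"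
    and w: "w \<in> mod_hom R (free_module R G) (free_module R G)"
    and E: "finite E" "E \<subseteq> carrier Y"
    and ew: "\<And>f. f \<in> carrier (free_module R G) \<Longrightarrow> e (w f) \<in> mod_span R Y E"
  shows "\<exists>A s. finite A \<and> A \<subseteq> carrier (free_module R G) \<and> s \<in> mod_hom R (free_module R G) F' \<and>
    (\<forall>f\<in>carrier (free_module R G).
       w f \<ominus>\<^bsub>free_module R G\<^esub> d (s f) \<in> mod_span R (free_module R G) A)"
proof -
  interpret Y: module R Y by fact
  let ?F = "free_module R G"
  have cr: "cring R" by (rule Y.is_cring)
  have mF: "module R ?F" by (rule module_free_module[OF cr])
  interpret F: module R ?F by (rule mF)
  \<comment> \<open>Only elements in the image of \<open>e\<close> can be lifted to the free module;
    noetherianity keeps this part of the span of \<open>E\<close> finitely generated.\<close>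
  let ?D = "e ` carrier ?F \<inter> mod_span R Y E"
  have D: "submodule ?D R Y"
    by (rule submodule_Int[OF assms(2) submodule_image[OF mF assms(2) e submodule_carrier[OF mF]]
        submodule_mod_span[OF assms(2) E(2)]])
  from noetherian_submodule_fin_gen[OF assms(1,2) E D Int_lower2]
  obtain B where B: "finite B" "B \<subseteq> ?D" "?D \<subseteq> mod_span R Y B" by blast
  then obtain A where A: "finite A" "A \<subseteq> carrier ?F" "B = e ` A"
    using finite_subset_image[of B e "carrier ?F"] by blast
  let ?A = "mod_span R ?F A"
  have sA: "submodule ?A R ?F" by (rule submodule_mod_span[OF mF A(2)])
  have "mod_span R Y B \<subseteq> e ` ?A"
    by (rule mod_span_minimal[OF submodule_image[OF mF assms(2) e sA]])
       (use A(3) mod_span_incl[of A] in blast)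
  with B(3) have DA: "?D \<subseteq> e ` ?A" by blast
  have lift: "\<exists>y\<in>carrier F'. w f \<ominus>\<^bsub>?F\<^esub> d y \<in> ?A" if f: "f \<in> carrier ?F" for f
  proof -
    have wf: "w f \<in> carrier ?F" by (rule mod_hom_closed[OF w f])
    then have "e (w f) \<in> ?D" using ew[OF f] by blast
    then obtain a where a: "a \<in> ?A" "e (w f) = e a" using DA by blast
    have aF: "a \<in> carrier ?F" using a(1) submodule_subset[OF sA] by blast
    have "e (w f \<ominus>\<^bsub>?F\<^esub> a) = \<zero>\<^bsub>Y\<^esub>"
      using a(2) mod_hom_closed[OF e aF]
      by (simp add: mod_hom_diff[OF mF assms(2) e wf aF] module_diff_zero_iff[OF assms(2)])
    then have "w f \<ominus>\<^bsub>?F\<^esub> a \<in> d ` carrier F'" using exact wf aF by auto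
    then obtain y where y: "y \<in> carrier F'" "d y = w f \<ominus>\<^bsub>?F\<^esub> a" by force
    have "w f \<ominus>\<^bsub>?F\<^esub> d y = (w f \<ominus>\<^bsub>?F\<^esub> w f) \<oplus>\<^bsub>?F\<^esub> a"
      using wf aF by (simp add: y(2) a_minus_def F.M.minus_add F.M.a_assoc)
    also have "\<dots> = a" using wf aF by (simp add: a_minus_def F.M.r_neg)
    finally show ?thesis using a(1) y(1) by auto
  qed
  \<comment> \<open>Preimages are chosen on basis vectors only. The linear extension
    \<open>s\<close> then works for every \<open>f\<close>, because the required condition cuts out
    a submodule.\<close>
  have "\<forall>g\<in>G. \<exists>y. y \<in> carrier F' \<and> w (std_basis R g) \<ominus>\<^bsub>?F\<^esub> d y \<in> ?A"
  proof
    fix g assume "g \<in> G"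
    from lift[OF std_basis_closed[OF cr this]]
    show "\<exists>y. y \<in> carrier F' \<and> w (std_basis R g) \<ominus>\<^bsub>?F\<^esub> d y \<in> ?A" by (simp only: Bex_def)
  qed
  from bchoice[OF this] obtain \<phi>
    where \<phi>_all: "\<forall>g\<in>G. \<phi> g \<in> carrier F' \<and> w (std_basis R g) \<ominus>\<^bsub>?F\<^esub> d (\<phi> g) \<in> ?A" ..
  note \<phi> = \<phi>_all[THEN bspec, THEN conjunct1] \<phi>_all[THEN bspec, THEN conjunct2]
  then have \<phi>': "\<phi> \<in> G \<rightarrow> carrier F'" by blast
  define s where "s = lin_ext R F' \<phi>"
  have s: "s \<in> mod_hom R ?F F'" unfolding s_def by (rule lin_ext_hom[OF assms(3) \<phi>'])
  have h: "(\<lambda>f. w f \<ominus>\<^bsub>?F\<^esub> d (s f)) \<in> mod_hom R ?F ?F"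
    by (rule mod_hom_diff_fun[OF mF w mod_hom_comp[OF s d]])
  have "carrier ?F \<subseteq> {f \<in> carrier ?F. w f \<ominus>\<^bsub>?F\<^esub> d (s f) \<in> ?A}"
    by (rule free_module_eq_if_basis[OF cr submodule_vimage[OF mF mF h sA]])
       (simp add: s_def lin_ext_std_basis[OF assms(3) \<phi>'] std_basis_closed[OF cr] \<phi>(2))
  then have "\<forall>f\<in>carrier ?F. w f \<ominus>\<^bsub>?F\<^esub> d (s f) \<in> ?A" by blast
  with A(1,2) s show ?thesis by (intro exI conjI)
qed

lemma module_std_res: "cring R \<Longrightarrow> module R (std_res R X i)"
  unfolding std_res_def by (rule module_free_module)

lemma std_diff_diff:
  assumes "module R X" "x \<in> carrier (std_res R X (Suc (Suc i)))"
  shows "std_diff R X i (std_diff R X (Suc i) x) = \<zero>\<^bsub>std_res R X i\<^esub>"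
  using std_resolution(5)[OF assms(1), of i] assms(2) by blast

lemma std_aug_diff:
  assumes "module R X" "x \<in> carrier (std_res R X (Suc 0))"
  shows "std_aug R X (std_diff R X 0 x) = \<zero>\<^bsub>X\<^esub>"
  using std_resolution(4)[OF assms(1)] assms(2) by blast

text \<open>
  The map \<open>t\<close> is a partial contracting homotopy: \<open>f - d (s f) - t (d f)\<close> is an endomorphism of
  the resolution that is homotopic to the identity and has finitely generated image in degree \<open>i\<close>.
\<close>

lemma std_res_homotopy:
  assumes "noetherian_ring R" "module R N" "fin_gen_module R N"
  defines "F \<equiv> std_res R N" and "d \<equiv> std_diff R N"
  shows "\<exists>w s A. w \<in> mod_hom R (F i) (F i) \<and> s \<in> mod_hom R (F i) (F (Suc i)) \<and>
    finite A \<and> A \<subseteq> carrier (F i) \<and>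
    (\<forall>f\<in>carrier (F i). w f \<ominus>\<^bsub>F i\<^esub> d i (s f) \<in> mod_span R (F i) A) \<and>
    (case i of 0 \<Rightarrow> \<forall>f\<in>carrier (F i). w f = f
     | Suc j \<Rightarrow> \<exists>t\<in>mod_hom R (F j) (F i). \<forall>f\<in>carrier (F i). w f = f \<ominus>\<^bsub>F i\<^esub> t (d j f))"
proof -
  interpret N: module R N by fact
  have cr: "cring R" by (rule N.is_cring)
  have mF: "module R (F i)" for i unfolding F_def by (rule module_std_res[OF cr])
  have free: "F i = free_module R (std_gens R N i)" for i by (simp add: F_def std_res_def)
  note res = std_resolution[OF assms(2), folded F_def d_def]
  note step = lift_modulo_fin_gen[OF assms(1), where G = "std_gens R N i" for i, folded free]
  show ?thesis
  proof (induction i)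
    case 0
    obtain E where E: "finite E" "E \<subseteq> carrier N" "\<And>H. submodule H R N \<Longrightarrow> E \<subseteq> H \<Longrightarrow> H = carrier N"
      using assms(3) unfolding fin_gen_module_def by blast
    \<comment> \<open>Finite generation of \<open>N\<close> starts the construction, with the
      augmentation as \<open>e\<close> and the identity as \<open>w\<close>.\<close>
    have "mod_span R N E = carrier N"
      by (rule E(3)[OF submodule_mod_span[OF assms(2) E(2)] mod_span_incl])
    then have "\<exists>A s. finite A \<and> A \<subseteq> carrier (F 0) \<and> s \<in> mod_hom R (F 0) (F (Suc 0)) \<and>
        (\<forall>f\<in>carrier (F 0). f \<ominus>\<^bsub>F 0\<^esub> d 0 (s f) \<in> mod_span R (F 0) A)"
      by (intro step[OF assms(2) mF res(2) res(1) _ mod_hom_id E(1,2)])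
         (simp_all add: res(4) mod_hom_closed[OF res(1)])
    then obtain A s where "finite A" "A \<subseteq> carrier (F 0)" "s \<in> mod_hom R (F 0) (F (Suc 0))"
      "\<forall>f\<in>carrier (F 0). f \<ominus>\<^bsub>F 0\<^esub> d 0 (s f) \<in> mod_span R (F 0) A"
      by (elim exE conjE)
    then show ?case
      by (intro exI[of _ "\<lambda>x. x"] exI[of _ s] exI[of _ A]) (simp add: mod_hom_id)
  next
    case (Suc i)
    then obtain w s A where *: "w \<in> mod_hom R (F i) (F i)" "s \<in> mod_hom R (F i) (F (Suc i))"
      "finite A" "A \<subseteq> carrier (F i)"
      "\<forall>f\<in>carrier (F i). w f \<ominus>\<^bsub>F i\<^esub> d i (s f) \<in> mod_span R (F i) A"
      and w_case: "case i of 0 \<Rightarrow> \<forall>f\<in>carrier (F i). w f = f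
         | Suc j \<Rightarrow> \<exists>t\<in>mod_hom R (F j) (F i). \<forall>f\<in>carrier (F i). w f = f \<ominus>\<^bsub>F i\<^esub> t (d j f)"
      by (elim exE conjE)
    \<comment> \<open>In positive degree \<open>w\<close> differs from the identity by
      \<open>t\<close> after \<open>d j\<close>, which kills boundaries; in degree zero it is the
      identity.\<close>
    have w_bd: "w (d i f) = d i f" if f: "f \<in> carrier (F (Suc i))" for f
    proof (cases i)
      case 0
      then show ?thesis using w_case mod_hom_closed[OF res(2) f] by simp
    next
      case (Suc j)
      interpret Fi: module R "F i" by (rule mF)
      have df: "d i f \<in> carrier (F i)" by (rule mod_hom_closed[OF res(2) f])
      obtain t where t: "t \<in> mod_hom R (F j) (F i)" "w (d i f) = d i f \<ominus>\<^bsub>F i\<^esub> t (d j (d i f))"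
        using w_case df by (auto simp: Suc)
      have "d j (d i f) = \<zero>\<^bsub>F j\<^esub>"
        using std_diff_diff[OF assms(2)] f by (simp add: Suc F_def d_def)
      then show ?thesis
        using t(2) df by (simp add: mod_hom_zero[OF mF mF t(1)] a_minus_def)
    qed
    \<comment> \<open>The \<open>s\<close> of this degree becomes the \<open>t\<close> of the next
      one.\<close>
    define v where "v f = f \<ominus>\<^bsub>F (Suc i)\<^esub> s (d i f)" for f
    have v: "v \<in> mod_hom R (F (Suc i)) (F (Suc i))"
      unfolding v_def by (rule mod_hom_diff_fun[OF mF mod_hom_id mod_hom_comp[OF res(2) *(2)]])
    \<comment> \<open>Since \<open>w\<close> fixes boundaries, \<open>d i (v f)\<close> is the
      difference of \<open>w\<close> and \<open>d i\<close> after \<open>s\<close>, evaluated at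
      \<open>d i f\<close>; the induction hypothesis places it in the span of
      \<open>A\<close>.\<close>
    have dv: "d i (v f) \<in> mod_span R (F i) A" if f: "f \<in> carrier (F (Suc i))" for f
    proof -
      have df: "d i f \<in> carrier (F i)" by (rule mod_hom_closed[OF res(2) f])
      have "d i (v f) = d i f \<ominus>\<^bsub>F i\<^esub> d i (s (d i f))"
        unfolding v_def by (rule mod_hom_diff[OF mF mF res(2) f mod_hom_closed[OF *(2) df]])
      then show ?thesis using *(5)[rule_format, OF df] by (simp add: w_bd[OF f])
    qed
    have "\<exists>A s. finite A \<and> A \<subseteq> carrier (F (Suc i)) \<and> s \<in> mod_hom R (F (Suc i)) (F (Suc (Suc i))) \<and>
        (\<forall>f\<in>carrier (F (Suc i)). v f \<ominus>\<^bsub>F (Suc i)\<^esub> d (Suc i) (s f) \<in> mod_span R (F (Suc i)) A)"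
      by (rule step[OF mF mF res(2) res(2) _ v *(3,4) dv]) (simp_all add: res(5))
    then obtain A' s' where A': "finite A'" "A' \<subseteq> carrier (F (Suc i))"
      "s' \<in> mod_hom R (F (Suc i)) (F (Suc (Suc i)))"
      "\<forall>f\<in>carrier (F (Suc i)). v f \<ominus>\<^bsub>F (Suc i)\<^esub> d (Suc i) (s' f) \<in> mod_span R (F (Suc i)) A'"
      by (elim exE conjE)
    have "\<exists>t\<in>mod_hom R (F i) (F (Suc i)). \<forall>f\<in>carrier (F (Suc i)).
        v f = f \<ominus>\<^bsub>F (Suc i)\<^esub> t (d i f)"
      using *(2) by (intro bexI[of _ s]) (auto simp: v_def)
    with v A' show ?case
      by (intro exI[of _ v] exI[of _ s'] exI[of _ A']) (simp only: nat.case simp_thms)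
  qed
qed

text \<open>In positive degree \<open>f = t (d f) + d (s f) + r f\<close> with \<open>r f\<close> in
  the span of \<open>A\<close>. A cocycle kills the middle term and, if it vanishes on
  \<open>A\<close>, also the last one. Hence \<open>c\<close> is \<open>c\<close> after
  \<open>t\<close> after \<open>d\<close>, a coboundary. In degree zero the first term is absent and
  \<open>c\<close> vanishes.\<close>

lemma cocycle_coboundary_if_zero_on_finite:
  assumes "noetherian_ring R" "module R N" "fin_gen_module R N" "module R M"
  obtains A where "finite A" "A \<subseteq> carrier (std_res R N i)"
    and "\<And>c. \<lbrakk>c \<in> hom_cocycles R (std_res R N) (std_diff R N) M i; \<And>a. a \<in> A \<Longrightarrow> c a = \<zero>\<^bsub>M\<^esub>\<rbrakk>
      \<Longrightarrow> c \<in> hom_coboundaries R (std_res R N) (std_diff R N) M i"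
proof -
  interpret N: module R N by fact
  interpret M: module R M by fact
  let ?F = "std_res R N" and ?d = "std_diff R N"
  have cr: "cring R" by (rule N.is_cring)
  have mF: "module R (?F i)" for i by (rule module_std_res[OF cr])
  note diff = std_resolution(2)[OF assms(2)]
  obtain w s A where *: "w \<in> mod_hom R (?F i) (?F i)" "s \<in> mod_hom R (?F i) (?F (Suc i))"
    "finite A" "A \<subseteq> carrier (?F i)"
    "\<forall>f\<in>carrier (?F i). w f \<ominus>\<^bsub>?F i\<^esub> ?d i (s f) \<in> mod_span R (?F i) A"
    and w_case: "case i of 0 \<Rightarrow> \<forall>f\<in>carrier (?F i). w f = f
       | Suc j \<Rightarrow> \<exists>t\<in>mod_hom R (?F j) (?F i). \<forall>f\<in>carrier (?F i). w f = f \<ominus>\<^bsub>?F i\<^esub> t (?d j f)"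
    using std_res_homotopy[OF assms(1-3), of i] by (elim exE conjE)
  have "c \<in> hom_coboundaries R ?F ?d M i"
    if c: "c \<in> hom_cocycles R ?F ?d M i" and cA: "\<And>a. a \<in> A \<Longrightarrow> c a = \<zero>\<^bsub>M\<^esub>" for c
  proof -
    have c_hom: "c \<in> mod_hom R (?F i) M" and c_ext: "c \<in> extensional (carrier (?F i))"
      and c_d: "\<And>x. x \<in> carrier (?F (Suc i)) \<Longrightarrow> c (?d i x) = \<zero>\<^bsub>M\<^esub>"
      using c by (auto simp: hom_cocycles_def hom_module_simps)
    have "mod_span R (?F i) A \<subseteq> {f \<in> carrier (?F i). c f = \<zero>\<^bsub>M\<^esub>}"
      by (rule mod_span_minimal[OF submodule_kernel[OF mF assms(4) c_hom]]) (use *(4) cA in auto)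
    then have c_w: "c (w f) = \<zero>\<^bsub>M\<^esub>" if f: "f \<in> carrier (?F i)" for f
    proof -
      have sf: "s f \<in> carrier (?F (Suc i))" by (rule mod_hom_closed[OF *(2) f])
      have wf: "w f \<in> carrier (?F i)" by (rule mod_hom_closed[OF *(1) f])
      have "c (w f) \<ominus>\<^bsub>M\<^esub> c (?d i (s f)) = c (w f \<ominus>\<^bsub>?F i\<^esub> ?d i (s f))"
        by (rule mod_hom_diff[OF mF assms(4) c_hom wf mod_hom_closed[OF diff sf], symmetric])
      also have "\<dots> = \<zero>\<^bsub>M\<^esub>"
        using *(5)[rule_format, OF f] \<open>mod_span R (?F i) A \<subseteq> {f \<in> carrier (?F i). c f = \<zero>\<^bsub>M\<^esub>}\<close> by blast
      finally show ?thesis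
        using mod_hom_closed[OF c_hom wf] by (simp add: c_d[OF sf] module_diff_zero_iff[OF assms(4)])
    qed
    show ?thesis
    proof (cases i)
      case 0
      then have "c f = \<zero>\<^bsub>M\<^esub>" if "f \<in> carrier (?F i)" for f
        using c_w[OF that] w_case that by simp
      then have "c = (\<lambda>x\<in>carrier (?F i). \<zero>\<^bsub>M\<^esub>)"
        using c_ext by (intro extensionalityI[of _ "carrier (?F i)"]) auto
      then show ?thesis by (simp add: 0 hom_module_simps)
    next
      case (Suc j)
      then obtain t where t: "t \<in> mod_hom R (?F j) (?F i)"
        "\<And>f. f \<in> carrier (?F i) \<Longrightarrow> w f = f \<ominus>\<^bsub>?F i\<^esub> t (?d j f)"
        using w_case by auto
      have d_cl: "?d j f \<in> carrier (?F j)" if "f \<in> carrier (?F i)" for f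
        using mod_hom_closed[OF diff] that by (simp add: Suc)
      let ?c = "\<lambda>x\<in>carrier (?F j). c (t x)"
      have c': "?c \<in> carrier (hom_module R (?F j) M)"
        using mod_hom_comp[OF t(1) c_hom] by (simp add: hom_module_simps mod_hom_restrict_iff[OF mF])
      have "c = (\<lambda>x\<in>carrier (?F (Suc j)). ?c (?d j x))"
      proof (rule extensionalityI[of _ "carrier (?F i)"])
        fix f assume f: "f \<in> carrier (?F i)"
        have tf: "t (?d j f) \<in> carrier (?F i)" by (rule mod_hom_closed[OF t(1) d_cl[OF f]])
        have "c f \<ominus>\<^bsub>M\<^esub> c (t (?d j f)) = \<zero>\<^bsub>M\<^esub>"
          using c_w[OF f] by (simp add: t(2)[OF f] mod_hom_diff[OF mF assms(4) c_hom f tf])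
        then have "c f = c (t (?d j f))"
          using mod_hom_closed[OF c_hom] f tf by (simp add: module_diff_zero_iff[OF assms(4)])
        then show "c f = (\<lambda>x\<in>carrier (?F (Suc j)). ?c (?d j x)) f"
          using f d_cl[OF f] by (simp add: Suc)
      qed (use c_ext in \<open>simp_all add: Suc\<close>)
      then show ?thesis unfolding Suc hom_coboundaries.simps by (rule image_eqI[OF _ c'])
    qed
  qed
  with *(3,4) show ?thesis by (rule that)
qed

section \<open>Ext of a finitely generated module into a member of the Serre class\<close>

lemma Ext_quotient:
  fixes i :: nat
  assumes "module R N" "module R M"
  defines "Z \<equiv> (hom_module R (std_res R N i) M)\<lparr>carrier :=
    hom_cocycles R (std_res R N) (std_diff R N) M i\<rparr>"
    and "B \<equiv> hom_coboundaries R (std_res R N) (std_diff R N) M i"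
  shows "module R Z" and "submodule B R Z" and "Ext R i N M = mod_quot Z B"
proof -
  interpret N: module R N by fact
  note mF = module_std_res[OF N.is_cring, of N]
  note diff = std_resolution(2)[OF assms(1)]
  show "module R Z"
    unfolding Z_def
    by (rule submodule_module[OF module_hom_module[OF mF assms(2)]
        submodule_hom_cocycles[where F = "std_res R N", OF mF diff assms(2)]])
  show "submodule B R Z"
    unfolding Z_def B_def
    by (rule submodule_hom_coboundaries[where F = "std_res R N", OF mF diff assms(2)
        std_diff_diff[OF assms(1)]])
  show "Ext R i N M = mod_quot Z B"
    by (simp add: Ext_def hom_cohomology_def Z_def B_def)
qed

proposition belongs_Ext_fin_gen:
  fixes S :: "('r, 'u) module set"
  assumes "infinite (UNIV :: 'u set)" "noetherian_ring R" "serre_subcategory R S" "M \<in> S"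
    and "module R N" "fin_gen_module R N"
  shows "belongs R S (Ext R i N M)"
proof -
  have mM: "module R M" by (rule serre_module[OF assms(3,4)])
  let ?Z = "(hom_module R (std_res R N i) M)\<lparr>carrier :=
    hom_cocycles R (std_res R N) (std_diff R N) M i\<rparr>"
  let ?B = "hom_coboundaries R (std_res R N) (std_diff R N) M i"
  note Ext = Ext_quotient[OF assms(5) mM, of i]
  note proj = mod_quot_proj[OF Ext(1,2)]
  \<comment> \<open>Evaluations at the points of \<open>A\<close> become the separating
    homomorphisms on the module of cocycles.\<close>
  obtain A where A: "finite A" "A \<subseteq> carrier (std_res R N i)"
    "\<And>c. \<lbrakk>c \<in> carrier ?Z; \<And>a. a \<in> A \<Longrightarrow> c a = \<zero>\<^bsub>M\<^esub>\<rbrakk> \<Longrightarrow> c \<in> ?B"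
    using cocycle_coboundary_if_zero_on_finite[OF assms(2,5,6) mM, of i] by auto
  show ?thesis
    unfolding Ext(3)
  proof (rule belongs_of_separating_homs[OF assms(1,3,4) Ext(1) proj(3,1,2) A(1)])
    show "(\<lambda>c. c a) \<in> mod_hom R ?Z M" if "a \<in> A" for a
      using A(2) that by (intro mod_homI) (auto simp: hom_cocycles_def hom_module_simps mod_hom_closed)
    show "?B +>\<^bsub>?Z\<^esub> c = \<zero>\<^bsub>mod_quot ?Z ?B\<^esub>"
      if "c \<in> carrier ?Z" "\<And>a. a \<in> A \<Longrightarrow> c a = \<zero>\<^bsub>M\<^esub>" for c
      using A(3) that by (simp only: proj(4))
  qed
qed

section \<open>Torsion from the support condition\<close>

text \<open>If \<open>x / 1\<close> were zero in the localization at \<open>p\<close>, some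
  \<open>u\<close> outside \<open>p\<close> would annihilate \<open>x\<close>.\<close>

lemma Supp_if_annihilator_subset:
  assumes "module R X" "primeideal p R" "x \<in> carrier X"
    and ann: "{r \<in> carrier R. r \<odot>\<^bsub>X\<^esub> x = \<zero>\<^bsub>X\<^esub>} \<subseteq> p"
  shows "p \<in> Supp R X"
proof -
  interpret X: module R X by fact
  interpret p: primeideal p R by fact
  have one: "\<one>\<^bsub>R\<^esub> \<in> carrier R - p" using p.one_imp_carrier p.I_notcarr by auto
  let ?r = "fraction_rel R p X"
  have "?r `` {(x, \<one>\<^bsub>R\<^esub>)} \<noteq> ?r `` {(\<zero>\<^bsub>X\<^esub>, \<one>\<^bsub>R\<^esub>)}"
  proof
    assume eq: "?r `` {(x, \<one>\<^bsub>R\<^esub>)} = ?r `` {(\<zero>\<^bsub>X\<^esub>, \<one>\<^bsub>R\<^esub>)}"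
    \<comment> \<open>Reflexivity at this pair places it in its own class, hence in the class of
      zero, and that membership yields the witness \<open>u\<close>.\<close>
    have "((x, \<one>\<^bsub>R\<^esub>), (x, \<one>\<^bsub>R\<^esub>)) \<in> ?r"
      using assms(3) one by (auto simp: fraction_rel_def)
    then have "((\<zero>\<^bsub>X\<^esub>, \<one>\<^bsub>R\<^esub>), (x, \<one>\<^bsub>R\<^esub>)) \<in> ?r" using eq by blast
    then obtain u where "u \<in> carrier R - p" "u \<odot>\<^bsub>X\<^esub> x = \<zero>\<^bsub>X\<^esub>"
      using assms(3) by (auto simp: fraction_rel_def)
    then show False using ann by blast
  qed
  moreover have "?r `` {(x, \<one>\<^bsub>R\<^esub>)} \<in> carrier (localization R p X)"
    using assms(3) one by (auto simp: localization_def intro!: quotientI)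
  ultimately have "carrier (localization R p X) \<noteq> {\<zero>\<^bsub>localization R p X\<^esub>}"
    by (auto simp: localization_def)
  then show ?thesis using assms(2) by (simp add: Supp_def)
qed

lemma ideal_annihilator:
  assumes "module R X" "x \<in> carrier X"
  shows "ideal {r \<in> carrier R. r \<odot>\<^bsub>X\<^esub> x = \<zero>\<^bsub>X\<^esub>} R"
proof -
  interpret X: module R X by fact
  show ?thesis
    by (rule ideal_intro[OF X.is_cring])
       (use assms(2) in \<open>auto simp: X.smult_l_distr X.smult_assoc1\<close>)
qed

text \<open>As the product of \<open>a\<close> and \<open>b\<close> lies in \<open>J\<close>, so
  does the product of the ideals \<open>J + (a)\<close> and \<open>J + (b)\<close>. This is the
  source of primality for a maximal ideal among those containing no power of
  \<open>I\<close>.\<close>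

lemma ideal_pow_mult_subset:
  assumes "cring R" "ideal I R" "ideal J R" "a \<in> carrier R" "b \<in> carrier R" "a \<otimes>\<^bsub>R\<^esub> b \<in> J"
    and m: "I [^]\<^bsub>ideals_set R\<^esub> (m::nat) \<subseteq> J <+>\<^bsub>R\<^esub> PIdl\<^bsub>R\<^esub> a"
    and n: "I [^]\<^bsub>ideals_set R\<^esub> (n::nat) \<subseteq> J <+>\<^bsub>R\<^esub> PIdl\<^bsub>R\<^esub> b"
  shows "I [^]\<^bsub>ideals_set R\<^esub> (m + n) \<subseteq> J"
proof -
  interpret cring R by fact
  interpret J: ideal J R by fact
  interpret IS: comm_monoid "ideals_set R" by (rule ideals_set_is_comm_monoid)
  have I: "I \<in> carrier (ideals_set R)" using assms(2) by (simp add: ideals_set_def)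
  have "I [^]\<^bsub>ideals_set R\<^esub> (m + n) = ideal_prod R (I [^]\<^bsub>ideals_set R\<^esub> m) (I [^]\<^bsub>ideals_set R\<^esub> n)"
    using IS.nat_pow_mult[OF I, of m n] by (simp add: ideals_set_def)
  also have "\<dots> \<subseteq> J"
  proof
    fix x assume "x \<in> ideal_prod R (I [^]\<^bsub>ideals_set R\<^esub> m) (I [^]\<^bsub>ideals_set R\<^esub> n)"
    then show "x \<in> J"
    proof (induction x rule: ideal_prod.induct)
      case (prod r s)
      have "r \<in> J <+>\<^bsub>R\<^esub> PIdl\<^bsub>R\<^esub> a" "s \<in> J <+>\<^bsub>R\<^esub> PIdl\<^bsub>R\<^esub> b"
        using prod m n by blast+
      then obtain j k u v where *: "j \<in> J" "u \<in> carrier R" "r = j \<oplus>\<^bsub>R\<^esub> u \<otimes>\<^bsub>R\<^esub> a"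
        "k \<in> J" "v \<in> carrier R" "s = k \<oplus>\<^bsub>R\<^esub> v \<otimes>\<^bsub>R\<^esub> b"
        by (auto simp: set_add_def' cgenideal_def)
      note c = *(2,5) J.Icarr[OF *(1)] J.Icarr[OF *(4)] assms(4,5)
      have "r \<otimes>\<^bsub>R\<^esub> s = (s \<otimes>\<^bsub>R\<^esub> j) \<oplus>\<^bsub>R\<^esub> ((u \<otimes>\<^bsub>R\<^esub> a) \<otimes>\<^bsub>R\<^esub> k \<oplus>\<^bsub>R\<^esub> (u \<otimes>\<^bsub>R\<^esub> v) \<otimes>\<^bsub>R\<^esub> (a \<otimes>\<^bsub>R\<^esub> b))"
        using c by (simp add: *(3,6) l_distr r_distr a_ac m_ac)
      moreover have "s \<in> carrier R" using c by (simp add: *(6))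
      ultimately show ?case
        using c *(1,4) assms(6) by (simp add: J.I_l_closed)
    qed simp
  qed
  finally show ?thesis .
qed

text \<open>
  An ideal maximal among those that contain \<open>J\<close> but no power of \<open>I\<close> would be prime.
\<close>

lemma noetherian_ideal_power_subset:
  assumes "cring R" "noetherian_ring R" "ideal I R" "ideal J R"
    and prime: "\<And>p. \<lbrakk>primeideal p R; J \<subseteq> p\<rbrakk> \<Longrightarrow> I \<subseteq> p"
  shows "\<exists>n::nat. I [^]\<^bsub>ideals_set R\<^esub> n \<subseteq> J"
proof (rule ccontr)
  assume contra: "\<nexists>n::nat. I [^]\<^bsub>ideals_set R\<^esub> n \<subseteq> J"
  interpret cring R by fact
  interpret noetherian_ring R by fact
  interpret IS: comm_monoid "ideals_set R" by (rule ideals_set_is_comm_monoid)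
  let ?P = "{p. ideal p R \<and> J \<subseteq> p \<and> (\<forall>n::nat. \<not> I [^]\<^bsub>ideals_set R\<^esub> n \<subseteq> p)}"
  have "\<exists>p\<in>?P. \<forall>q\<in>?P. p \<subseteq> q \<longrightarrow> q = p"
  proof (rule subset_Zorn_nonempty)
    show "?P \<noteq> {}" using contra assms(4) by auto
    fix C assume C: "C \<noteq> {}" "subset.chain ?P C"
    then have "subset.chain {p. ideal p R} C" by (auto simp: subset.chain_def)
    \<comment> \<open>In a noetherian ring the union of a nonempty chain of ideals is one of its
      members, so it inherits the conditions defining \<open>?P\<close>.\<close>
    then have "\<Union>C \<in> C" by (rule ideal_chain_is_trivial[OF C(1)])
    moreover have "C \<subseteq> ?P" using C(2) by (simp only: subset.chain_def)
    ultimately show "\<Union>C \<in> ?P" by (rule rev_subsetD)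
  qed
  then obtain p where P: "p \<in> ?P" and max: "\<forall>q\<in>?P. p \<subseteq> q \<longrightarrow> q = p" ..
  from P have p: "ideal p R" "J \<subseteq> p" "\<not> I [^]\<^bsub>ideals_set R\<^esub> (n::nat) \<subseteq> p" for n
    by blast+
  \<comment> \<open>Adjoining \<open>a\<close> gives a strictly larger ideal, which maximality
    excludes from \<open>?P\<close>; the only condition it can fail is the one on powers.\<close>
  have power: "\<exists>n::nat. I [^]\<^bsub>ideals_set R\<^esub> n \<subseteq> p <+>\<^bsub>R\<^esub> PIdl\<^bsub>R\<^esub> a"
    if a: "a \<in> carrier R" "a \<notin> p" for a
  proof -
    interpret p: ideal p R by (rule p(1))
    interpret a: ideal "PIdl\<^bsub>R\<^esub> a" R by (rule cgenideal_ideal[OF a(1)])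
    have q: "ideal (p <+>\<^bsub>R\<^esub> PIdl\<^bsub>R\<^esub> a) R" by (rule add_ideals[OF p(1) cgenideal_ideal[OF a(1)]])
    have "x \<in> p <+>\<^bsub>R\<^esub> PIdl\<^bsub>R\<^esub> a" if "x \<in> p" for x
    proof -
      have "x = x \<oplus>\<^bsub>R\<^esub> \<zero>\<^bsub>R\<^esub>" using p.Icarr[OF that] by simp
      then show ?thesis using that a.zero_closed unfolding set_add_def' by blast
    qed
    then have sub: "p \<subseteq> p <+>\<^bsub>R\<^esub> PIdl\<^bsub>R\<^esub> a" ..
    have "a = \<zero>\<^bsub>R\<^esub> \<oplus>\<^bsub>R\<^esub> a" using a(1) by simp
    then have "a \<in> p <+>\<^bsub>R\<^esub> PIdl\<^bsub>R\<^esub> a"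
      using p.zero_closed cgenideal_self[OF a(1)] unfolding set_add_def' by blast
    then have "p <+>\<^bsub>R\<^esub> PIdl\<^bsub>R\<^esub> a \<noteq> p" using a(2) by blast
    then have "p <+>\<^bsub>R\<^esub> PIdl\<^bsub>R\<^esub> a \<notin> ?P" using max[rule_format, OF _ sub] by blast
    then show ?thesis using q sub p(2) by auto
  qed
  have "primeideal p R"
  proof (rule primeidealI[OF p(1) assms(1)])
    \<comment> \<open>The zeroth power of \<open>I\<close> is the whole ring, so \<open>p\<close> is
      proper.\<close>
    show "carrier R \<noteq> p" using p(3)[of 0] by (auto simp: ideals_set_def)
    fix a b assume ab: "a \<in> carrier R" "b \<in> carrier R" "a \<otimes>\<^bsub>R\<^esub> b \<in> p"
    show "a \<in> p \<or> b \<in> p"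
      using power[OF ab(1)] power[OF ab(2)] ideal_pow_mult_subset[OF assms(1,3) p(1) ab] p(3)
      by blast
  qed
  \<comment> \<open>The first power of \<open>I\<close> thus lies in \<open>p\<close>, against the
    choice of \<open>p\<close>.\<close>
  then have "I \<subseteq> p" using prime p(2) by blast
  moreover have "I [^]\<^bsub>ideals_set R\<^esub> (1::nat) = I"
    using assms(3) by (intro IS.nat_pow_eone) (simp add: ideals_set_def)
  ultimately show False using p(3)[of 1] by simp
qed

text \<open>The power criterion is applied to the annihilator of each \<open>x\<close>: a prime
  containing it lies in the support, hence contains \<open>I\<close>.\<close>

lemma torsion_part_eq_carrier:
  assumes "noetherian_ring R" "ideal I R" "module R X" "Supp R X \<subseteq> zero_locus R I"
  shows "torsion_part R I X = carrier X"
proof -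
  interpret X: module R X by fact
  have "\<exists>n::nat. \<forall>r\<in>I [^]\<^bsub>ideals_set R\<^esub> n. r \<odot>\<^bsub>X\<^esub> x = \<zero>\<^bsub>X\<^esub>" if x: "x \<in> carrier X" for x
  proof -
    have "I \<subseteq> p" if "primeideal p R" "{r \<in> carrier R. r \<odot>\<^bsub>X\<^esub> x = \<zero>\<^bsub>X\<^esub>} \<subseteq> p" for p
      using Supp_if_annihilator_subset[OF assms(3) that(1) x that(2)] assms(4)
      by (auto simp: zero_locus_def)
    from noetherian_ideal_power_subset[OF X.is_cring assms(1,2) ideal_annihilator[OF assms(3) x] this]
    show ?thesis by blast
  qed
  then show ?thesis by (auto simp: torsion_part_def)
qed

section \<open>Ext in degree zero\<close>

lemma annihilated_part_carrier:
  "carrier (annihilated_part I X) = {x \<in> carrier X. \<forall>r\<in>I. r \<odot>\<^bsub>X\<^esub> x = \<zero>\<^bsub>X\<^esub>}"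
  by (simp add: annihilated_part_def)

lemma submodule_annihilated_part:
  assumes "module R X" "ideal I R"
  shows "submodule (carrier (annihilated_part I X)) R X"
proof -
  interpret X: module R X by fact
  interpret I: ideal I R by fact
  show ?thesis
  proof (rule submodule_intro[OF assms(1)])
    show "s \<odot>\<^bsub>X\<^esub> x \<in> carrier (annihilated_part I X)"
      if s: "s \<in> carrier R" and x: "x \<in> carrier (annihilated_part I X)" for s x
    proof -
      have "r \<odot>\<^bsub>X\<^esub> (s \<odot>\<^bsub>X\<^esub> x) = \<zero>\<^bsub>X\<^esub>" if r: "r \<in> I" for r
      proof -
        have "r \<odot>\<^bsub>X\<^esub> (s \<odot>\<^bsub>X\<^esub> x) = s \<odot>\<^bsub>X\<^esub> (r \<odot>\<^bsub>X\<^esub> x)"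
          using s x I.Icarr[OF r]
          by (simp add: annihilated_part_carrier X.m_comm flip: X.smult_assoc1)
        then show ?thesis using x r s by (simp add: annihilated_part_carrier)
      qed
      then show ?thesis using s x by (simp add: annihilated_part_carrier)
    qed
  qed (auto simp: annihilated_part_carrier I.Icarr X.smult_r_distr)
qed

text \<open>An element \<open>x\<close> killed by \<open>I\<close> gives the map from
  \<open>R/I\<close> to \<open>X\<close> sending the class of \<open>r\<close> to
  \<open>r x\<close>; after the augmentation this is a cocycle of degree zero. An embedding
  suffices, since Serre classes are closed under submodules.\<close>

lemma annihilated_part_embeds_Ext_0:
  assumes "module R X" "ideal I R"
  defines "Q \<equiv> mod_quot (ring_as_module R) I"
  shows "\<exists>f\<in>mod_hom R (annihilated_part I X) (Ext R 0 Q X).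
    inj_on f (carrier (annihilated_part I X))"
proof -
  interpret X: module R X by fact
  interpret I: ideal I R by fact
  have cr: "cring R" by (rule X.is_cring)
  let ?R = "ring_as_module R" and ?A = "annihilated_part I X"
  let ?F = "std_res R Q" and ?d = "std_diff R Q"
  have mR: "module R ?R" by (rule module_ring_as_module[OF cr])
  note proj = mod_quot_proj[OF mR submodule_ideal[OF cr assms(2)], folded Q_def]
  define \<pi> where "\<pi> r = I +>\<^bsub>?R\<^esub> r" for r
  have \<pi>: "\<pi> \<in> mod_hom R ?R Q" "\<pi> ` carrier ?R = carrier Q"
    using proj(1,2) unfolding \<pi>_def by auto
  have \<pi>_zero: "\<pi> r = \<zero>\<^bsub>Q\<^esub> \<longleftrightarrow> r \<in> I" if "r \<in> carrier ?R" for r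
    unfolding \<pi>_def by (rule proj(4)[OF that])
  have mQ: "module R Q" by (rule proj(3))
  have carR: "carrier ?R = carrier R" by (simp add: ring_as_module_def)
  have mF: "module R (?F i)" for i by (rule module_std_res[OF cr])
  note res = std_resolution[OF mQ]
  note A = submodule_annihilated_part[OF assms(1,2)]
  have A_eq: "?A = X\<lparr>carrier := carrier ?A\<rparr>" by (simp add: annihilated_part_def)
  have mA: "module R ?A" using submodule_module[OF assms(1) A] A_eq by metis
  have A_ops: "add ?A = add X" "smult ?A = smult X" "zero ?A = zero X"
    by (simp_all add: annihilated_part_def)
  have AX: "x \<in> carrier X" if "x \<in> carrier ?A" for x using that submodule_subset[OF A] by blast
  \<comment> \<open>Coset representatives, chosen without linearity. By \<open>\<rho>_smult\<close>
    the choice does not affect the action on elements killed by \<open>I\<close>.\<close>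
  define \<rho> where "\<rho> = inv_into (carrier R) \<pi>"
  have \<rho>: "\<rho> q \<in> carrier R" "\<pi> (\<rho> q) = q" if "q \<in> carrier Q" for q
    unfolding \<rho>_def using that \<pi>(2)[symmetric]
    by (simp_all add: carR inv_into_into f_inv_into_f)
  have \<rho>_smult: "\<rho> (\<pi> r) \<odot>\<^bsub>X\<^esub> x = r \<odot>\<^bsub>X\<^esub> x" if r: "r \<in> carrier R" and x: "x \<in> carrier ?A" for r x
  proof -
    have q: "\<pi> r \<in> carrier Q" using mod_hom_closed[OF \<pi>(1)] r carR by blast
    have "\<pi> (\<rho> (\<pi> r) \<ominus>\<^bsub>?R\<^esub> r) = \<zero>\<^bsub>Q\<^esub>"
      using \<rho>[OF q] r q
      by (simp add: mod_hom_diff[OF mR mQ \<pi>(1)] carR module_diff_zero_iff[OF mQ])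
    \<comment> \<open>Subtraction in \<open>ring_as_module R\<close> is rewritten in the operations
      of \<open>R\<close>, so that the resulting element of \<open>I\<close> can act on
      \<open>x\<close>.\<close>
    moreover have "\<rho> (\<pi> r) \<ominus>\<^bsub>?R\<^esub> r = \<rho> (\<pi> r) \<oplus>\<^bsub>R\<^esub> (\<ominus>\<^bsub>R\<^esub> \<one>\<^bsub>R\<^esub>) \<otimes>\<^bsub>R\<^esub> r"
      using r by (simp add: a_minus_def[of ?R] module_minus_eq[OF mR] carR)
        (simp add: ring_as_module_def)
    ultimately have "\<rho> (\<pi> r) \<oplus>\<^bsub>R\<^esub> (\<ominus>\<^bsub>R\<^esub> \<one>\<^bsub>R\<^esub>) \<otimes>\<^bsub>R\<^esub> r \<in> I"
      using \<pi>_zero[of "\<rho> (\<pi> r) \<oplus>\<^bsub>R\<^esub> (\<ominus>\<^bsub>R\<^esub> \<one>\<^bsub>R\<^esub>) \<otimes>\<^bsub>R\<^esub> r"] \<rho>(1)[OF q] r by (simp add: carR)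
    then have "(\<rho> (\<pi> r) \<oplus>\<^bsub>R\<^esub> (\<ominus>\<^bsub>R\<^esub> \<one>\<^bsub>R\<^esub>) \<otimes>\<^bsub>R\<^esub> r) \<odot>\<^bsub>X\<^esub> x = \<zero>\<^bsub>X\<^esub>"
      using x by (simp add: annihilated_part_carrier)
    then have "\<rho> (\<pi> r) \<odot>\<^bsub>X\<^esub> x \<ominus>\<^bsub>X\<^esub> r \<odot>\<^bsub>X\<^esub> x = \<zero>\<^bsub>X\<^esub>"
      using \<rho>(1)[OF q] r AX[OF x]
      by (simp add: X.smult_l_distr X.smult_l_minus X.l_minus a_minus_def)
    then show ?thesis
      using \<rho>(1)[OF q] r AX[OF x] by (simp add: module_diff_zero_iff[OF assms(1)])
  qed
  define h where "h x = (\<lambda>f\<in>carrier (?F 0). \<rho> (std_aug R Q f) \<odot>\<^bsub>X\<^esub> x)" for x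
  have aug: "std_aug R Q f \<in> carrier Q" if "f \<in> carrier (?F 0)" for f
    by (rule mod_hom_closed[OF res(1) that])
  let ?Z = "(hom_module R (?F 0) X)\<lparr>carrier := hom_cocycles R ?F ?d X 0\<rparr>"
  let ?B = "hom_coboundaries R ?F ?d X 0"
  note Ext = Ext_quotient[OF mQ assms(1), of 0]
  note q = mod_quot_proj[OF Ext(1,2)]
  have hZ: "h x \<in> carrier ?Z" if x: "x \<in> carrier ?A" for x
  proof -
    have "(\<lambda>f. \<rho> (std_aug R Q f) \<odot>\<^bsub>X\<^esub> x) \<in> mod_hom R (?F 0) X"
    proof (rule mod_homI)
      fix f g assume f: "f \<in> carrier (?F 0)" and g: "g \<in> carrier (?F 0)"
      have "std_aug R Q (f \<oplus>\<^bsub>?F 0\<^esub> g) = \<pi> (\<rho> (std_aug R Q f)) \<oplus>\<^bsub>Q\<^esub> \<pi> (\<rho> (std_aug R Q g))"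
        using f g by (simp add: mod_hom_add[OF res(1)] aug \<rho>)
      also have "\<dots> = \<pi> (\<rho> (std_aug R Q f) \<oplus>\<^bsub>R\<^esub> \<rho> (std_aug R Q g))"
        using mod_hom_add[OF \<pi>(1), of "\<rho> (std_aug R Q f)" "\<rho> (std_aug R Q g)"] f g
        by (simp add: aug \<rho> ring_as_module_def)
      finally show "\<rho> (std_aug R Q (f \<oplus>\<^bsub>?F 0\<^esub> g)) \<odot>\<^bsub>X\<^esub> x =
          \<rho> (std_aug R Q f) \<odot>\<^bsub>X\<^esub> x \<oplus>\<^bsub>X\<^esub> \<rho> (std_aug R Q g) \<odot>\<^bsub>X\<^esub> x"
        using f g x by (simp add: \<rho>_smult aug \<rho> AX X.smult_l_distr)
    next
      fix r f assume r: "r \<in> carrier R" and f: "f \<in> carrier (?F 0)"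
      have "std_aug R Q (r \<odot>\<^bsub>?F 0\<^esub> f) = r \<odot>\<^bsub>Q\<^esub> \<pi> (\<rho> (std_aug R Q f))"
        using r f by (simp add: mod_hom_smult[OF res(1)] aug \<rho>)
      also have "\<dots> = \<pi> (r \<otimes>\<^bsub>R\<^esub> \<rho> (std_aug R Q f))"
        using mod_hom_smult[OF \<pi>(1) r, of "\<rho> (std_aug R Q f)"] f
        by (simp add: aug \<rho> ring_as_module_def)
      finally show "\<rho> (std_aug R Q (r \<odot>\<^bsub>?F 0\<^esub> f)) \<odot>\<^bsub>X\<^esub> x = r \<odot>\<^bsub>X\<^esub> (\<rho> (std_aug R Q f) \<odot>\<^bsub>X\<^esub> x)"
        using r f x by (simp add: \<rho>_smult aug \<rho> AX X.smult_assoc1)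
    qed (use x in \<open>simp add: aug \<rho> AX\<close>)
    moreover have "h x (?d 0 f) = \<zero>\<^bsub>X\<^esub>" if f: "f \<in> carrier (?F (Suc 0))" for f
    proof -
      \<comment> \<open>The chosen representative of the zero coset may be nonzero, but it acts as
        zero on \<open>x\<close>.\<close>
      have "std_aug R Q (?d 0 f) = \<pi> \<zero>\<^bsub>R\<^esub>"
        using \<pi>_zero[of "\<zero>\<^bsub>R\<^esub>"] by (simp add: std_aug_diff[OF mQ f] carR)
      then show ?thesis
        using mod_hom_closed[OF res(2) f] x by (simp add: h_def \<rho>_smult AX)
    qed
    ultimately show ?thesis
      by (simp add: hom_cocycles_def hom_module_simps mod_hom_restrict_iff[OF mF] h_def)
  qed
  have h: "h \<in> mod_hom R ?A ?Z"
  proof (rule mod_homI[OF hZ])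
    show "h (x \<oplus>\<^bsub>?A\<^esub> y) = h x \<oplus>\<^bsub>?Z\<^esub> h y" if "x \<in> carrier ?A" "y \<in> carrier ?A" for x y
      using that by (auto simp: h_def hom_module_simps A_ops AX aug \<rho> X.smult_r_distr intro!: restrict_ext)
    show "h (r \<odot>\<^bsub>?A\<^esub> x) = r \<odot>\<^bsub>?Z\<^esub> h x" if "r \<in> carrier R" "x \<in> carrier ?A" for r x
      using that by (auto simp: h_def hom_module_simps A_ops AX aug \<rho> X.m_comm
          simp flip: X.smult_assoc1 intro!: restrict_ext)
  qed
  let ?f = "\<lambda>x. ?B +>\<^bsub>?Z\<^esub> h x"
  have f: "?f \<in> mod_hom R ?A (mod_quot ?Z ?B)" by (rule mod_hom_comp[OF h q(1)])
  moreover have "inj_on ?f (carrier ?A)"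
    unfolding mod_hom_inj_iff[OF mA q(3) f]
  proof (intro ballI impI)
    fix x assume x: "x \<in> carrier ?A" and "?f x = \<zero>\<^bsub>mod_quot ?Z ?B\<^esub>"
    then have "h x \<in> ?B" using q(4)[OF hZ[OF x]] by simp
    \<comment> \<open>In degree zero the only coboundary is the zero map.\<close>
    then have hx: "h x = (\<lambda>f\<in>carrier (?F 0). \<zero>\<^bsub>X\<^esub>)" by (simp add: hom_module_simps)
    have "\<pi> \<one>\<^bsub>R\<^esub> \<in> carrier Q" using mod_hom_closed[OF \<pi>(1)] carR X.R.one_closed by blast
    \<comment> \<open>Evaluating \<open>h x\<close> over the class of one returns
      \<open>x\<close>.\<close>
    then obtain f where f: "f \<in> carrier (?F 0)" "std_aug R Q f = \<pi> \<one>\<^bsub>R\<^esub>"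
      using res(3) by (metis imageE)
    have "\<zero>\<^bsub>X\<^esub> = h x f" using f(1) by (simp add: hx)
    also have "\<dots> = x" using f x by (simp add: h_def \<rho>_smult AX)
    finally show "x = \<zero>\<^bsub>?A\<^esub>" by (simp add: A_ops)
  qed
  ultimately show ?thesis unfolding Ext(3) by blast
qed

section \<open>Cofinite modules lie in the Serre class\<close>

lemma cofinite_module_mem:
  fixes S :: "('r, 'u) module set" and M :: "('r, 'u) module"
  assumes "noetherian_ring R" "ideal I R" "serre_subcategory R S" "condition_C R I S"
    and "cofinite_module R S I M"
  shows "M \<in> S"
proof -
  have M: "module R M" "Supp R M \<subseteq> zero_locus R I"
    and bel: "belongs R S (Ext R 0 (mod_quot (ring_as_module R) I) M)"
    using assms(5) by (simp_all add: cofinite_module_def)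
  interpret M: module R M by fact
  let ?Q = "mod_quot (ring_as_module R) I" and ?A = "annihilated_part I M"
  have mQ: "module R ?Q"
    by (rule mod_quot_proj(3)[OF module_ring_as_module submodule_ideal]) (rule M.is_cring assms(2))+
  have mE: "module R (Ext R 0 ?Q M)"
    using Ext_quotient[OF mQ M(1), of 0] mod_quot_proj(3) by metis
  have mA: "module R ?A"
    using submodule_module[OF M(1) submodule_annihilated_part[OF M(1) assms(2)]]
    by (simp add: annihilated_part_def)
  obtain f where f: "f \<in> mod_hom R ?A (Ext R 0 ?Q M)" "inj_on f (carrier ?A)"
    using annihilated_part_embeds_Ext_0[OF M(1) assms(2)] by blast
  have "belongs R S ?A" by (rule belongs_sub[OF assms(3) bel mA mE f])
  then obtain Y g where "Y \<in> S" "g \<in> mod_hom R ?A Y" "bij_betw g (carrier ?A) (carrier Y)"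
    unfolding belongs_def mod_iso_def by blast
  \<comment> \<open>\<open>belongs\<close> provides only an isomorphic object of \<open>S\<close>.
    Since \<open>?A\<close> already lives on \<open>'u\<close>, closure under submodules yields the
    literal membership that \<open>condition_C\<close> asks for.\<close>
  then have "?A \<in> S" using serre_sub[OF assms(3) _ mA] bij_betw_imp_inj_on by blast
  then show ?thesis
    using assms(4) M(1) torsion_part_eq_carrier[OF assms(1,2) M] unfolding condition_C_def by blast
qed

theorem theorem2p4:
  fixes R :: "('r, 'x) ring_scheme" and I :: "'r set"
    and S :: "('r, 'u) module set"
    and M :: "('r, 'u) module" and N :: "('r, 'n) module" and d :: ereal
  assumes "infinite (UNIV :: 'u set)"
    and "cring R" and "noetherian_ring R" and "ideal I R"
    and "serre_subcategory R S" and "condition_C R I S"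
    and "cofinite_module R S I M"
    and "module R N" and "fin_gen_module R N"
    and "krull_dim R N = d" and "d < \<infinity>"
  shows "\<forall>i. belongs R S (Ext R i N M)"
  using belongs_Ext_fin_gen[OF assms(1,3,5) cofinite_module_mem[OF assms(3-7)] assms(8,9)] ..

end
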